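(* Suppose that $\{x\in\mathbb{R}^n:Ax=b\}$ is nonempty, that $f=h+g$ where $h:\mathbb{R}^n\to\mathbb{R}$ is differentiable with $\nabla h$ Lipschitz continuous with constant $L_h>0$, and $g:\mathbb{R}^n\to\mathbb{R}$ is proper, lower semicontinuous, $\rho_g$-weakly convex ($\rho_g>0$) and has the implicit Lipschitz subgradient property with constant $L_g>0$ (possibly depending on $\gamma$). Let $\{(x^k,z^k,\lambda^k)\}$ be generated by LiMEAL with a fixed penalty parameter $\beta_k=\beta>0$, and suppose it is bounded. If $\gamma\in\big(0,\frac1{\rho_g+L_h}\big)$, $\eta\in(0,2)$, the number $\alpha:=\frac{2\beta+\gamma\eta(1-\eta/2)}{2c_{\gamma,A}\beta^2}$ satisfies $$0<\alpha<\min\left\{\frac1{8\gamma}\Big(\frac2\eta-1\Big),\ \frac{1-\gamma(\rho_g+L_h)}{8\gamma\left((1+\gamma L_g)^2+\gamma^2L_h^2\right)}\right\},$$ and $\mathcal{P}_{\mathrm{limeal}}$ satisfies the Kurdyka-{\L}ojasiewicz property at some point $y^*:=(x^*,x^*,\lambda^*,x^*,x^* )$ with an exponent $\theta\in[0,1)$, where $(x^*,\lambda^* )$ is a limit point of $\{(x^k,\lambda^k)\}$, then: (a) the whole sequence $\{\hat y^k:=(x^k,z^k,\lambda^k)\}$ converges to $\hat y^*:=(x^*,x^*,\lambda^* )$; and (b) the following rates hold: (1) if $\theta=0$, then $\{\hat y^k\}$ converges within a finite number of iterations; (2) if $\theta\in(0,\frac12]$, then $\|\hat y^k-\hat y^*\|\le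 c\tau^k$ for all $k\ge k_0$, for certain $k_0>0$, $c>0$, $\tau\in(0,1)$; (3) if $\theta\in(\frac12,1)$, then $\|\hat y^k-\hat y^*\|\le c\,k^{-\frac{1-\theta}{2\theta-1}}$ for all $k\ge k_0$, for certain $k_0>0$, $c>0$.
   Context: The problem is to minimize $f(x)=h(x)+g(x)$ over $x\in\mathbb{R}^n$ subject to $Ax=b$, with $A\in\mathbb{R}^{m\times n}$, $b\in\mathbb{R}^m$. $\|\cdot\|$ is the Euclidean norm. A function $q$ is $\rho$-weakly convex ($\rho>0$) if $q+\frac{\rho}{2}\|\cdot\|^2$ is convex. Moreau envelope and prox: $\mathcal{M}_{\gamma,q}(z)=\min_x\{q(x)+\frac1{2\gamma}\|x-z\|^2\}$, $\mathrm{Prox}_{\gamma,q}(z)=\operatorname{argmin}_x\{q(x)+\frac1{2\gamma}\|x-z\|^2\}$. If $q$ is proper, lower semicontinuous, $\rho$-weakly convex and $\gamma\in(0,\rho^{-1})$, the prox is single-valued and $\mathcal{M}_{\gamma,q}$ is differentiable with $\nabla\mathcal{M}_{\gamma,q}(z)=\gamma^{-1}(z-\mathrm{Prox}_{\gamma,q}(z))$. For $x\in\mathrm{ran}(\mathrm{Prox}_{\gamma,q})$ let $\mathrm{Prox}_{\gamma,q}^{-1}(x)=\{w:\mathrm{Prox}_{\gamma,q}(w)=x\}$. Implicit Lipschitz subgradient property of a $\rho$-weakly convex $q$: for any $\gamma\in(0,\rho^{-1})$ there is $L>0$ (depending on $\gamma$) such that for all $u,v\in\mathrm{ran}(\mathrm{Prox}_{\gamma,q})$,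 all $w\in\mathrm{Prox}_{\gamma,q}^{-1}(u)$ and $w'\in\mathrm{Prox}_{\gamma,q}^{-1}(v)$: $\|\nabla\mathcal{M}_{\gamma,q}(w)-\nabla\mathcal{M}_{\gamma,q}(w')\|\le L\|u-v\|$. For $\beta>0$: $\mathcal{L}_\beta(x,\lambda)=f(x)+\langle\lambda,Ax-b\rangle+\frac\beta2\|Ax-b\|^2$ and $\mathcal{P}_\beta(x,z,\lambda)=\mathcal{L}_\beta(x,\lambda)+\frac1{2\gamma}\|x-z\|^2$. LiMEAL with fixed $\beta$: given $(x^0,z^0,\lambda^0)$, put $f^k(x)=h(x^k)+\langle\nabla h(x^k),x-x^k\rangle+g(x)$ and, for $k=0,1,\dots$: $x^{k+1}=\operatorname{argmin}_x\{f^k(x)+\langle\lambda^k,Ax-b\rangle+\frac{\beta}2\|Ax-b\|^2+\frac1{2\gamma}\|x-z^k\|^2\}$, $z^{k+1}=z^k-\eta(z^k-x^{k+1})$, $\lambda^{k+1}=\lambda^k+\beta(Ax^{k+1}-b)$. $c_{\gamma,A}=\gamma^2\tilde\sigma_{\min}(A^TA)$, where $\tilde\sigma_{\min}(A^TA)$ is the smallest positive eigenvalue of $A^TA$. For $y=(x,z,\lambda,\hat x,\hat z)\in\mathbb{R}^n\times\mathbb{R}^n\times\mathbb{R}^m\times\mathbb{R}^n\times\mathbb{R}^n$, $\mathcal{P}_{\mathrm{limeal}}(y)=\mathcal{P}_\beta(x,z,\lambda)+4\alpha\left(\|z-\hat z\|^2+\gamma^2L_h^2\|x-\hat x\|^2\right)$.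 Limiting subdifferential: the Fr\'echet subdifferential $\widehat\partial q(x)$ at $x\in\mathrm{dom}(q)$ is the set of $v$ with $\liminf_{u\ne x,u\to x}\frac{q(u)-q(x)-\langle v,u-x\rangle}{\|x-u\|}\ge0$ (empty if $x\notin\mathrm{dom}(q)$), and $\partial q(x)=\{v:\exists x^t\to x,\ q(x^t)\to q(x),\ \widehat\partial q(x^t)\ni v^t\to v\}$. Kurdyka-{\L}ojasiewicz property: $q$ has it at $x^*\in\mathrm{dom}(\partial q)$ with exponent $\theta\in[0,1)$ if there exist a neighborhood $\mathcal{U}$ of $x^*$, $\nu>0$ and $\varphi(s)=cs^{1-\theta}$ with $c>0$ such that for all $x\in\mathcal{U}\cap\mathrm{dom}(\partial q)$ with $q(x^* )<q(x)<q(x^* )+\nu$: $\varphi'(q(x)-q(x^* ))\cdot\mathrm{dist}(0,\partial q(x))\ge1$ (conventions $0^0=1$, $\infty/\infty=0/0=0$), where $\mathrm{dist}(x,S)=\inf_{u\in S}\|x-u\|$. *)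

theory Defs
  imports "HOL-Analysis.Analysis"
begin

text \<open>All objective functions are finite-valued, i.e. of type \<^typ>\<open>'a \<Rightarrow> real\<close>. Hence they are
  proper, and their domain in the sense of convex analysis is the whole space.\<close>

definition gradient :: "('a::real_inner \<Rightarrow> real) \<Rightarrow> 'a \<Rightarrow> 'a" where
  "gradient q x = (THE v. GDERIV q x :> v)"

definition lower_semicont :: "('a::topological_space \<Rightarrow> real) \<Rightarrow> bool" where
  "lower_semicont q \<longleftrightarrow> (\<forall>x. ereal (q x) \<le> Liminf (at x) (\<lambda>u. ereal (q u)))"

definition weakly_convex :: "real \<Rightarrow> ('a::real_inner \<Rightarrow> real) \<Rightarrow> bool" where
  "weakly_convex \<rho> q \<longleftrightarrow> \<rho> > 0 \<and> convex_on UNIV (\<lambda>x. q x + \<rho> / 2 * (norm x)\<^sup>2)"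

text \<open>For a lower semicontinuous \<open>\<rho>\<close>-weakly convex function and \<open>0 < \<gamma> < 1 / \<rho>\<close> the infimum below
  is attained at exactly one point, which is then the value of \<open>prox\<close>. Outside this range the values
  may be arbitrary, and they are not used.\<close>

definition moreau_env :: "real \<Rightarrow> ('a::real_inner \<Rightarrow> real) \<Rightarrow> 'a \<Rightarrow> real" where
  "moreau_env \<gamma> q z = (INF x. q x + 1 / (2 * \<gamma>) * (norm (x - z))\<^sup>2)"

definition prox :: "real \<Rightarrow> ('a::real_inner \<Rightarrow> real) \<Rightarrow> 'a \<Rightarrow> 'a" where
  "prox \<gamma> q z = (ARG_MIN (\<lambda>x. q x + 1 / (2 * \<gamma>) * (norm (x - z))\<^sup>2) x. True)"

text \<open>The constant may depend on \<open>\<gamma>\<close>, so it is a function \<open>L\<close> of \<open>\<gamma>\<close>.\<close>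

definition implicit_lipschitz_subgradient ::
    "real \<Rightarrow> ('a::real_inner \<Rightarrow> real) \<Rightarrow> (real \<Rightarrow> real) \<Rightarrow> bool" where
  "implicit_lipschitz_subgradient \<rho> q L \<longleftrightarrow>
     (\<forall>\<gamma>. 0 < \<gamma> \<and> \<gamma> < 1 / \<rho> \<longrightarrow>
        L \<gamma> > 0 \<and>
        (\<forall>u \<in> range (prox \<gamma> q). \<forall>v \<in> range (prox \<gamma> q).
           \<forall>w \<in> prox \<gamma> q -` {u}. \<forall>w' \<in> prox \<gamma> q -` {v}.
             norm (gradient (moreau_env \<gamma> q) w - gradient (moreau_env \<gamma> q) w') \<le> L \<gamma> * norm (u - v)))"

definition aug_lagrangian ::
    "(real^'n \<Rightarrow> real) \<Rightarrow> real^'n^'m \<Rightarrow> real^'m \<Rightarrow> real \<Rightarrow> real^'n \<Rightarrow> real^'m \<Rightarrow> real" where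
  "aug_lagrangian f A b \<beta> x l = f x + l \<bullet> (A *v x - b) + \<beta> / 2 * (norm (A *v x - b))\<^sup>2"

definition prox_aug_lagrangian ::
    "(real^'n \<Rightarrow> real) \<Rightarrow> real^'n^'m \<Rightarrow> real^'m \<Rightarrow> real \<Rightarrow> real \<Rightarrow> real^'n \<Rightarrow> real^'n \<Rightarrow> real^'m \<Rightarrow> real" where
  "prox_aug_lagrangian f A b \<beta> \<gamma> x z l =
     aug_lagrangian f A b \<beta> x l + 1 / (2 * \<gamma>) * (norm (x - z))\<^sup>2"

definition linearized :: "('a::real_inner \<Rightarrow> real) \<Rightarrow> ('a \<Rightarrow> real) \<Rightarrow> 'a \<Rightarrow> 'a \<Rightarrow> real" where
  "linearized h g x0 x = h x0 + gradient h x0 \<bullet> (x - x0) + g x"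

definition limeal ::
    "(real^'n \<Rightarrow> real) \<Rightarrow> (real^'n \<Rightarrow> real) \<Rightarrow> real^'n^'m \<Rightarrow> real^'m \<Rightarrow> real \<Rightarrow> real \<Rightarrow> real \<Rightarrow>
     (nat \<Rightarrow> real^'n) \<Rightarrow> (nat \<Rightarrow> real^'n) \<Rightarrow> (nat \<Rightarrow> real^'m) \<Rightarrow> bool" where
  "limeal h g A b \<beta> \<gamma> \<eta> x z l \<longleftrightarrow>
     (\<forall>k. is_arg_min (\<lambda>u. prox_aug_lagrangian (linearized h g (x k)) A b \<beta> \<gamma> u (z k) (l k))
            (\<lambda>_. True) (x (Suc k)) \<and>
          z (Suc k) = z k - \<eta> *\<^sub>R (z k - x (Suc k)) \<and>
          l (Suc k) = l k + \<beta> *\<^sub>R (A *v x (Suc k) - b))"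

definition real_eigenvalue :: "real^'n^'n \<Rightarrow> real \<Rightarrow> bool" where
  "real_eigenvalue M s \<longleftrightarrow> (\<exists>v. v \<noteq> 0 \<and> M *v v = s *\<^sub>R v)"

text \<open>The set below is finite. It is empty for the Gram matrix of \<open>A = 0\<close>, where the minimum is
  unspecified.\<close>

definition min_pos_eigenvalue :: "real^'n^'n \<Rightarrow> real" where
  "min_pos_eigenvalue M = Min {s. 0 < s \<and> real_eigenvalue M s}"

definition c_const :: "real \<Rightarrow> real^'n^'m \<Rightarrow> real" where
  "c_const \<gamma> A = \<gamma>\<^sup>2 * min_pos_eigenvalue (transpose A ** A)"

definition P_limeal ::
    "(real^'n \<Rightarrow> real) \<Rightarrow> real^'n^'m \<Rightarrow> real^'m \<Rightarrow> real \<Rightarrow> real \<Rightarrow> real \<Rightarrow> real \<Rightarrow>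
     (real^'n) \<times> (real^'n) \<times> (real^'m) \<times> (real^'n) \<times> (real^'n) \<Rightarrow> real" where
  "P_limeal f A b \<beta> \<gamma> \<alpha> Lh = (\<lambda>(x, z, l, x', z').
     prox_aug_lagrangian f A b \<beta> \<gamma> x z l
       + 4 * \<alpha> * ((norm (z - z'))\<^sup>2 + \<gamma>\<^sup>2 * Lh\<^sup>2 * (norm (x - x'))\<^sup>2))"

definition frechet_subdiff :: "('a::real_inner \<Rightarrow> real) \<Rightarrow> 'a \<Rightarrow> 'a set" where
  "frechet_subdiff q x =
     {v. 0 \<le> Liminf (at x) (\<lambda>u. ereal ((q u - q x - v \<bullet> (u - x)) / norm (x - u)))}"

definition limiting_subdiff :: "('a::real_inner \<Rightarrow> real) \<Rightarrow> 'a \<Rightarrow> 'a set" where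
  "limiting_subdiff q x =
     {v. \<exists>X V. X \<longlonglongrightarrow> x \<and> (\<lambda>t. q (X t)) \<longlonglongrightarrow> q x \<and>
               (\<forall>t. V t \<in> frechet_subdiff q (X t)) \<and> V \<longlonglongrightarrow> v}"

definition dom_subdiff :: "('a::real_inner \<Rightarrow> real) \<Rightarrow> 'a set" where
  "dom_subdiff q = {x. limiting_subdiff q x \<noteq> {}}"

text \<open>The arguments of \<^const>\<open>deriv\<close> and \<^const>\<open>infdist\<close> below are a positive number and a nonempty
  set, respectively, so no convention about degenerate values is needed.\<close>

definition KL_property :: "('a::real_inner \<Rightarrow> real) \<Rightarrow> 'a \<Rightarrow> real \<Rightarrow> bool" where
  "KL_property q p \<theta> \<longleftrightarrow>
     0 \<le> \<theta> \<and> \<theta> < 1 \<and> p \<in> dom_subdiff q \<and>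
     (\<exists>U \<nu> c. open U \<and> p \<in> U \<and> \<nu> > 0 \<and> c > 0 \<and>
        (\<forall>y \<in> U \<inter> dom_subdiff q. q p < q y \<and> q y < q p + \<nu> \<longrightarrow>
           deriv (\<lambda>s. c * s powr (1 - \<theta>)) (q y - q p) * infdist 0 (limiting_subdiff q y) \<ge> 1))"

end

theory Submission
  imports Defs
begin

text \<open>Put \<open>Y k = (x (k+1), z (k+1), l (k+1), x k, z k)\<close>, let \<open>P\<close> be the function \<^const>\<open>P_limeal\<close>, and let
  \<open>D k\<close> be the total length of the two primal steps from \<open>k\<close> to \<open>k + 1\<close> and from \<open>k + 1\<close> to \<open>k + 2\<close>.
  Convergence follows from three estimates in terms of \<open>D\<close>:

  \<^item> descent, \<open>c * (D k)\<^sup>2 \<le> P (Y k) - P (Y (k+1))\<close> (\<open>lyapunov_descent\<close>);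
  \<^item> relative error, a limiting subgradient of \<open>P\<close> at \<open>Y (k+1)\<close> of norm at most \<open>K * D k\<close>
    (\<open>relative_error\<close>);
  \<^item> step length, \<open>dist (Y (k+1)) (Y k) \<le> K * D k\<close> (\<open>Y_step\<close>).

  The multiplier update increases the augmented Lagrangian by \<open>\<parallel>l (k+1) - l k\<parallel>\<^sup>2 / \<beta>\<close>, and the main point is
  that primal steps pay for this increase (\<open>dual_change_bound\<close>). The multipliers differ by an element
  of the range of \<open>A\<close>, so their difference is controlled by its image under \<open>A\<^sup>T\<close> and the smallest
  positive eigenvalue of \<open>A\<^sup>T A\<close> (\<open>min_pos_eigenvalue_gram_bound\<close>). The optimality condition of the
  \<open>x\<close>-update expresses that image by increments of \<open>x\<close>, \<open>z\<close>, \<open>\<nabla>h\<close> and of subgradients of \<open>g\<close>. The latter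
  are gradients of the Moreau envelope (\<open>prox_at_subgradient_step\<close>), where the implicit Lipschitz
  property applies. The extra terms of \<open>P\<close> absorb the part of the increase that stems from the
  older of the two steps.

  Subgradients enter only through quadratic minorants (\<open>proximal_subgradient\<close>). Minimality of \<open>x (k+1)\<close>
  gives such a minorant of \<open>g\<close> with a crude constant, weak convexity improves the constant to \<open>\<rho>/2\<close>, and
  quadratic minorants add up to one of \<open>P\<close>, hence to a limiting subgradient.

  With \<open>E k = P (Y k) - P p\<close>, where \<open>p\<close> is the cluster point, the Kurdyka-Lojasiewicz inequality and the
  relative error give \<open>E (k+1) powr \<theta> \<le> C * D k\<close> while \<open>Y (k+1)\<close> is near \<open>p\<close>. Concavity of \<open>s powr (1 - \<theta>)\<close>
  turns this and the descent into a telescoping bound for the steps, which traps the sequence near \<open>p\<close>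
  and bounds its distance to \<open>p\<close> by powers of the energy \<open>E\<close> (\<open>kl_descent_distance\<close>). The rates are those of
  \<open>E\<close>, which satisfies \<open>E (k+1) powr (2 * \<theta>) \<le> B * (E k - E (k+1))\<close> (\<open>kl_descent_rates\<close>).\<close>

section \<open>Decay of real sequences\<close>

lemma powr_minus_half:
  fixes x e :: real
  assumes "x \<ge> 0"
  shows "(x / 2) powr (- e) = 2 powr e * x powr (- e)"
proof -
  have "(x / 2) powr (- e) = x powr (- e) / 2 powr (- e)" by (rule powr_divide)
  also have "(2::real) powr (- e) = inverse (2 powr e)" by (rule powr_minus)
  finally show ?thesis by (simp only: divide_inverse inverse_inverse_eq mult.commute)
qed

text \<open>The recursion is a discrete version of \<open>a' = - a powr p / C\<close>, whose solutions decay like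
  \<open>t powr (- 1 / (p - 1))\<close>. By induction \<open>a\<close> stays below a multiple \<open>M\<close> of this function: if it did not, one
  step would have to lose more than the function itself loses, which the mean value theorem excludes
  for large \<open>M\<close>.\<close>

lemma sublinear_decay:
  fixes a :: "nat \<Rightarrow> real"
  assumes nonneg: "\<And>k. 0 \<le> a k" and C: "C > 0" and p: "p > 1"
    and rec: "\<And>k. a (Suc k) powr p \<le> C * (a k - a (Suc k))"
  shows "\<exists>M>0. \<forall>k. a k \<le> M * real (Suc k) powr (- (1 / (p - 1)))"
proof -
  define q where "q = 1 / (p - 1)"
  have q: "q > 0" "q * (p - 1) = 1" using p by (auto simp: q_def)
  \<comment> \<open>\<open>q\<close> is the expected decay exponent; \<open>T\<close> is what the mean value theorem requires of \<open>M powr (p - 1)\<close>\<close>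
  have qp: "q * p = q + 1" using q by (simp add: algebra_simps)
  define T where "T = C * q * 2 powr (q + 1)"
  have T: "T > 0" using C q by (simp add: T_def)
  define M where "M = max (a 0) (T powr q)"
  have M: "M > 0" "a 0 \<le> M" "T powr q \<le> M" using T by (auto simp: M_def less_max_iff_disj)
  have "(T powr q) powr (p - 1) \<le> M powr (p - 1)"
    using M(3) p by (intro powr_mono2) auto
  then have TM: "T \<le> M powr (p - 1)" using T q by (simp add: powr_powr)
  have "a k \<le> M * real (Suc k) powr (- q)" for k
  proof (induction k)
    case 0 then show ?case using M by simp
  next
    case (Suc k)
    define n where "n = real (Suc k)"
    have n: "n \<ge> 1" "real (Suc (Suc k)) = n + 1" by (auto simp: n_def)
    show ?case
    proof (rule ccontr)
      assume "\<not> ?thesis"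
      then have gt: "M * (n + 1) powr (- q) < a (Suc k)" unfolding n(2) by simp
      have "M powr p * (n + 1) powr (- (q + 1)) = (M * (n + 1) powr (- q)) powr p"
        using qp by (simp add: powr_mult powr_powr)
      also have "\<dots> \<le> a (Suc k) powr p"
        using gt M p by (intro powr_mono2) auto
      also have "\<dots> \<le> C * (a k - a (Suc k))" by (rule rec)
      also have "\<dots> < C * (M * n powr (- q) - M * (n + 1) powr (- q))"
        using gt Suc.IH C unfolding n_def by (intro mult_strict_left_mono) auto
      also have "\<dots> = C * M * (n powr (- q) - (n + 1) powr (- q))" by (simp add: algebra_simps)
      also have "\<dots> \<le> C * M * (q * 2 powr (q + 1) * (n + 1) powr (- (q + 1)))"
      proof (intro mult_left_mono)
        have "\<exists>\<xi>. n < \<xi> \<and> \<xi> < n + 1 \<and>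
            (n + 1) powr (- q) - n powr (- q) = (n + 1 - n) * (- q * \<xi> powr (- q - 1))"
        proof (rule MVT2)
          fix s assume "n \<le> s"
          then show "((\<lambda>s. s powr - q) has_real_derivative - q * s powr (- q - 1)) (at s)"
            using n by (auto intro!: derivative_eq_intros)
        qed simp
        then obtain \<xi> where \<xi>: "n < \<xi>"
          and mvt: "(n + 1) powr (- q) - n powr (- q) = (n + 1 - n) * (- q * \<xi> powr (- q - 1))"
          by blast
        have expo: "- q - 1 = - (q + 1)" and one: "n + 1 - n = 1" by simp_all
        have \<xi>_eq: "n powr (- q) - (n + 1) powr (- q) = q * \<xi> powr (- (q + 1))"
          using mvt[unfolded expo one mult_1_left] by linarith
        \<comment> \<open>\<open>\<xi> \<ge> n \<ge> (n + 1) / 2\<close>, which costs a factor \<open>2 powr (q + 1)\<close>\<close>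
        have "\<xi> powr (- (q + 1)) \<le> ((n + 1) / 2) powr (- (q + 1))"
          using \<xi> n q by (intro powr_mono2') auto
        also have "\<dots> = 2 powr (q + 1) * (n + 1) powr (- (q + 1))"
          using n by (intro powr_minus_half) auto
        finally show "n powr (- q) - (n + 1) powr (- q) \<le> q * 2 powr (q + 1) * (n + 1) powr (- (q + 1))"
          unfolding \<xi>_eq mult.assoc
          using q by (intro mult_left_mono) auto
      qed (use C M in auto)
      also have "\<dots> = T * M * (n + 1) powr (- (q + 1))" by (simp add: T_def)
      finally have "M powr p < T * M"
        using n by (simp add: mult_less_cancel_right)
      moreover have "M powr p = M powr (p - 1) * M" using M by (simp add: powr_diff)
      ultimately show False using TM M by auto
    qed
  qed
  then show ?thesis using M q_def by auto
qed

text \<open>Concavity of \<open>s powr (1 - \<theta>)\<close>, multiplied by \<open>a powr \<theta>\<close>: in this form it is Young's inequality.\<close>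

lemma powr_concave_tangent:
  fixes a b \<theta> :: real
  assumes "0 \<le> b" "b \<le> a" "0 < a" "0 \<le> \<theta>" "\<theta> < 1"
  shows "(1 - \<theta>) * (a - b) \<le> a powr \<theta> * (a powr (1 - \<theta>) - b powr (1 - \<theta>))"
proof -
  have aa: "a powr \<theta> * a powr (1 - \<theta>) = a"
    using assms by (simp flip: powr_add)
  have "a powr \<theta> * b powr (1 - \<theta>) \<le> \<theta> * a + (1 - \<theta>) * b"
  proof (cases "b = 0")
    case False
    then show ?thesis using assms by (intro Youngs_inequality_0) auto
  qed (use assms in simp)
  then show ?thesis using aa by (simp add: algebra_simps)
qed

section \<open>Sequences trapped near a cluster point\<close>

text \<open>The step bound is known only while the sequence is in the ball. The start leaves the room \<open>\<Phi> n\<close>,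
  and since the steps telescope in \<open>\<Phi>\<close>, this room is never used up.\<close>

lemma trapped_steps:
  fixes w :: "nat \<Rightarrow> 'a::metric_space"
  assumes step: "\<And>k. k \<ge> n \<Longrightarrow> dist (w k) p < r \<Longrightarrow> dist (w (Suc k)) (w k) \<le> \<Phi> k - \<Phi> (Suc k)"
    and start: "dist (w n) p + \<Phi> n < r" and nonneg: "\<And>k. (0::real) \<le> \<Phi> k"
    and "k \<ge> n"
  shows "dist (w k) (w n) \<le> \<Phi> n - \<Phi> k" "dist (w k) p < r"
proof -
  have "dist (w k) (w n) \<le> \<Phi> n - \<Phi> k \<and> dist (w k) p < r"
    using \<open>k \<ge> n\<close>
  proof (induction k rule: dec_induct)
    case base
    then show ?case using start nonneg[of n] by simp
  next
    case (step k)
    then have "dist (w (Suc k)) (w k) \<le> \<Phi> k - \<Phi> (Suc k)" using assms(1) by auto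
    then have *: "dist (w (Suc k)) (w n) \<le> \<Phi> n - \<Phi> (Suc k)"
      using step dist_triangle[of "w (Suc k)" "w n" "w k"] by linarith
    then show ?case
      using start nonneg[of "Suc k"] dist_triangle[of "w (Suc k)" p "w n"] by linarith
  qed
  then show "dist (w k) (w n) \<le> \<Phi> n - \<Phi> k" "dist (w k) p < r" by auto
qed

text \<open>Near the cluster point and for small \<open>\<Phi>\<close> the trap closes. From then on \<open>\<Phi>\<close> bounds the distance to all
  later elements of the sequence, and hence the distance to the cluster point.\<close>

lemma trapped_distance_to_cluster_point:
  fixes w :: "nat \<Rightarrow> 'a::metric_space"
  assumes step: "\<And>k. k \<ge> n0 \<Longrightarrow> dist (w k) p < r \<Longrightarrow> dist (w (Suc k)) (w k) \<le> \<Phi> k - \<Phi> (Suc k)"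
    and nonneg: "\<And>k. (0::real) \<le> \<Phi> k" and \<Phi>: "\<Phi> \<longlonglongrightarrow> 0"
    and r: "r > 0" and s: "strict_mono s" "(w \<circ> s) \<longlonglongrightarrow> p"
  shows "\<exists>n. \<forall>k\<ge>n. dist (w k) p < r \<and> dist (w k) p \<le> \<Phi> k"
proof -
  have s_top: "filterlim s at_top sequentially" by (rule filterlim_subseq[OF s(1)])
  have dist_s: "(\<lambda>j. dist (w (s j)) p) \<longlonglongrightarrow> 0"
    using s(2) unfolding o_def by (rule tendsto_dist_iff[THEN iffD1])
  have "(\<lambda>j. dist (w (s j)) p + \<Phi> (s j)) \<longlonglongrightarrow> 0 + 0"
    using dist_s filterlim_compose[OF \<Phi> s_top] by (rule tendsto_add)
  then have "\<forall>\<^sub>F j in sequentially. dist (w (s j)) p + \<Phi> (s j) < r"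
    using r by (intro order_tendstoD) auto
  moreover have "\<forall>\<^sub>F j in sequentially. s j \<ge> n0"
    using s_top by (auto simp: filterlim_at_top)
  ultimately have "\<forall>\<^sub>F j in sequentially. dist (w (s j)) p + \<Phi> (s j) < r \<and> s j \<ge> n0"
    by (rule eventually_conj)
  then obtain j where "dist (w (s j)) p + \<Phi> (s j) < r" "s j \<ge> n0"
    by (auto simp: eventually_sequentially)
  then obtain n where n: "dist (w n) p + \<Phi> n < r" "n \<ge> n0" by blast
  have step': "dist (w (Suc k)) (w k) \<le> \<Phi> k - \<Phi> (Suc k)" if "k \<ge> n" "dist (w k) p < r" for k
    using step that n by auto
  have in_ball: "dist (w k) p < r" if "k \<ge> n" for k
    using trapped_steps(2)[of n w p r \<Phi> k] step' n nonneg that by auto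
  have le: "dist (w m) (w k) \<le> \<Phi> k" if "k \<ge> n" "m \<ge> k" for k m
  proof -
    have "dist (w m) (w k) \<le> \<Phi> k - \<Phi> m"
      using that(2)
    proof (induction m rule: dec_induct)
      case (step m)
      then have "m \<ge> n" using that by simp
      then have "dist (w (Suc m)) (w m) \<le> \<Phi> m - \<Phi> (Suc m)" using step' in_ball by blast
      then show ?case using step dist_triangle[of "w (Suc m)" "w k" "w m"] by linarith
    qed simp
    then show ?thesis using nonneg[of m] by linarith
  qed
  have "dist (w k) p \<le> \<Phi> k" if "k \<ge> n" for k
  proof (rule tendsto_upperbound[where f = "\<lambda>j. dist (w (s j)) (w k)" and F = sequentially])
    show "(\<lambda>j. dist (w (s j)) (w k)) \<longlonglongrightarrow> dist (w k) p"
      using s(2) by (subst dist_commute) (auto intro!: tendsto_intros simp: o_def)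
    have "\<forall>\<^sub>F j in sequentially. s j \<ge> k" using s_top by (auto simp: filterlim_at_top)
    then show "\<forall>\<^sub>F j in sequentially. dist (w (s j)) (w k) \<le> \<Phi> k"
      by eventually_elim (use le that in auto)
  qed auto
  then show ?thesis using in_ball by blast
qed

section \<open>Descent sequences with a Kurdyka-Lojasiewicz inequality\<close>

text \<open>The Kurdyka-Lojasiewicz argument in abstract form, where \<open>E\<close> is the energy above the limit and \<open>D\<close> measures
  the steps. Concavity of \<open>s powr (1 - \<theta>)\<close>, the descent and the inequality for \<open>E powr \<theta>\<close> yield
  \<open>(D (k+1))\<^sup>2 \<le> D k * \<delta>\<close> with \<open>\<delta>\<close> a multiple of the decrease of \<open>E powr (1 - \<theta>)\<close>. Taking roots,
  \<open>2 * D (k+1) \<le> D k + \<delta>\<close>, and this says that \<open>D (k+1)\<close> is at most the decrease of \<open>D k + K * E (k+1) powr (1 - \<theta>)\<close>.\<close>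

lemma kl_descent_distance:
  fixes Y :: "nat \<Rightarrow> 'a::metric_space" and D E :: "nat \<Rightarrow> real"
  assumes D: "\<And>k. 0 \<le> D k" and E0: "\<And>k. 0 \<le> E k" and E: "E \<longlonglongrightarrow> 0"
    and c: "c1 > 0" "c3 > 0" "C > 0" and r: "r > 0" and \<nu>: "\<nu> > 0" and \<theta>: "0 \<le> \<theta>" "\<theta> < 1"
    and descent: "\<And>k. c1 * (D k)\<^sup>2 \<le> E k - E (Suc k)"
    and step: "\<And>k. dist (Y (Suc k)) (Y k) \<le> c3 * D k"
    and s: "strict_mono s" "(Y \<circ> s) \<longlonglongrightarrow> p"
    and KL: "\<And>k. dist (Y (Suc k)) p < r \<Longrightarrow> 0 < E (Suc k) \<Longrightarrow> E (Suc k) < \<nu> \<Longrightarrow>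
               E (Suc k) powr \<theta> \<le> C * D k"
  shows "\<exists>N K. K > 0 \<and> D \<longlonglongrightarrow> 0 \<and> (\<forall>k\<ge>N. dist (Y (Suc k)) p \<le> K * (D k + E (Suc k) powr (1 - \<theta>)) \<and>
            (0 < E (Suc k) \<longrightarrow> E (Suc k) powr \<theta> \<le> C * D k))"
proof -
  define K where "K = C / ((1 - \<theta>) * c1)"
  have K: "K > 0" using c \<theta> by (simp add: K_def)
  define \<Phi> where "\<Phi> k = c3 * (D k + K * E (Suc k) powr (1 - \<theta>))" for k
  have E_Suc: "(\<lambda>k. E (Suc k)) \<longlonglongrightarrow> 0" using E by (rule LIMSEQ_Suc)
  have "(\<lambda>k. (E k - E (Suc k)) / c1) \<longlonglongrightarrow> (0 - 0) / c1"
    using E E_Suc c by (intro tendsto_intros) auto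
  then have quot: "(\<lambda>k. (E k - E (Suc k)) / c1) \<longlonglongrightarrow> 0" by simp
  have "(\<lambda>k. (D k)\<^sup>2) \<longlonglongrightarrow> 0"
  proof (rule real_tendsto_sandwich[OF _ _ tendsto_const quot])
    show "\<forall>\<^sub>F k in sequentially. (D k)\<^sup>2 \<le> (E k - E (Suc k)) / c1"
      using descent c by (simp add: pos_le_divide_eq mult.commute)
  qed auto
  then have "(\<lambda>k. sqrt ((D k)\<^sup>2)) \<longlonglongrightarrow> sqrt 0" by (rule tendsto_real_sqrt)
  then have D_lim: "D \<longlonglongrightarrow> 0" using D by simp
  have "(\<lambda>k. E (Suc k) powr (1 - \<theta>)) \<longlonglongrightarrow> 0 powr (1 - \<theta>)"
    using E_Suc \<theta> E0 by (intro tendsto_powr') auto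
  then have "\<Phi> \<longlonglongrightarrow> c3 * (0 + K * 0)"
    unfolding \<Phi>_def using D_lim \<theta> by (intro tendsto_intros) auto
  then have \<Phi>_lim: "\<Phi> \<longlonglongrightarrow> 0" by simp
  obtain n0 where n0: "\<And>k. k \<ge> n0 \<Longrightarrow> E (Suc k) < \<nu>"
    using order_tendstoD(2)[OF E_Suc \<nu>] by (auto simp: eventually_sequentially)
  have contraction: "2 * D (Suc k) \<le> D k + K * (E (Suc k) powr (1 - \<theta>) - E (Suc (Suc k)) powr (1 - \<theta>))"
    if k: "k \<ge> n0" "dist (Y (Suc k)) p < r" for k
  proof (cases "E (Suc k) = 0")
    case True
    with descent[of "Suc k"] E0[of "Suc (Suc k)"] have "c1 * (D (Suc k))\<^sup>2 \<le> 0" by linarith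
    with c have "D (Suc k) = 0" by (simp add: mult_le_0_iff)
    moreover have "E (Suc (Suc k)) = 0"
      using True descent[of "Suc k"] \<open>D (Suc k) = 0\<close> E0[of "Suc (Suc k)"] by simp
    ultimately show ?thesis using True D by simp
  next
    case False
    define a b where "a = E (Suc k)" and "b = E (Suc (Suc k))"
    have a: "a > 0" using False E0[of "Suc k"] by (simp add: a_def)
    have desc: "c1 * (D (Suc k))\<^sup>2 \<le> a - b" using descent[of "Suc k"] by (simp add: a_def b_def)
    moreover have "0 \<le> c1 * (D (Suc k))\<^sup>2" using c by simp
    ultimately have b: "0 \<le> b" "b \<le> a" using E0 by (simp_all add: b_def)
    define \<delta> where "\<delta> = a powr (1 - \<theta>) - b powr (1 - \<theta>)"
    have \<delta>: "\<delta> \<ge> 0" using a b \<theta> by (simp add: \<delta>_def powr_mono2)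
    have "(1 - \<theta>) * (c1 * (D (Suc k))\<^sup>2) \<le> (1 - \<theta>) * (a - b)"
      using desc \<theta> by (intro mult_left_mono) auto
    also have "\<dots> \<le> a powr \<theta> * \<delta>"
      unfolding \<delta>_def using a b \<theta> by (intro powr_concave_tangent)
    also have "\<dots> \<le> C * D k * \<delta>"
      using KL[OF k(2)] a n0[OF k(1)] \<delta> by (intro mult_right_mono) (auto simp: a_def)
    finally have "(D (Suc k))\<^sup>2 \<le> D k * (K * \<delta>)"
      using \<theta> c by (simp add: K_def field_simps)
    moreover have "4 * (D k * (K * \<delta>)) \<le> (D k + K * \<delta>)\<^sup>2"
      using zero_le_power2[of "D k - K * \<delta>"] by (simp add: power2_eq_square algebra_simps)
    ultimately have "(2 * D (Suc k))\<^sup>2 \<le> (D k + K * \<delta>)\<^sup>2" by (simp add: power_mult_distrib)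
    then have "2 * D (Suc k) \<le> D k + K * \<delta>"
      by (rule power2_le_imp_le) (use D \<delta> K in auto)
    then show ?thesis by (simp add: \<delta>_def a_def b_def)
  qed
  have "\<exists>n. \<forall>k\<ge>n. dist (Y (Suc k)) p < r \<and> dist (Y (Suc k)) p \<le> \<Phi> k"
  proof (rule trapped_distance_to_cluster_point[where w = "\<lambda>k. Y (Suc k)" and s = s and ?n0.0 = n0])
    fix k assume k: "k \<ge> n0" "dist (Y (Suc k)) p < r"
    have "dist (Y (Suc (Suc k))) (Y (Suc k)) \<le> c3 * D (Suc k)" by (rule step)
    also have "\<dots> \<le> c3 * ((D k + K * E (Suc k) powr (1 - \<theta>)) - (D (Suc k) + K * E (Suc (Suc k)) powr (1 - \<theta>)))"
      using contraction[OF k] c by (intro mult_left_mono) (auto simp: algebra_simps)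
    finally show "dist (Y (Suc (Suc k))) (Y (Suc k)) \<le> \<Phi> k - \<Phi> (Suc k)"
      by (simp add: \<Phi>_def algebra_simps)
  next
    have "(\<lambda>j. dist (Y (s j)) p) \<longlonglongrightarrow> 0"
      using s(2) unfolding o_def by (rule tendsto_dist_iff[THEN iffD1])
    moreover have "(\<lambda>j. c3 * D (s j)) \<longlonglongrightarrow> c3 * 0"
      using filterlim_compose[OF D_lim filterlim_subseq[OF s(1)]] by (rule tendsto_mult_left)
    ultimately have "(\<lambda>j. dist (Y (s j)) p + c3 * D (s j)) \<longlonglongrightarrow> 0 + c3 * 0"
      by (rule tendsto_add)
    then have lim0: "(\<lambda>j. dist (Y (s j)) p + c3 * D (s j)) \<longlonglongrightarrow> 0" by simp
    have "(\<lambda>j. dist (Y (Suc (s j))) p) \<longlonglongrightarrow> 0"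
    proof (rule real_tendsto_sandwich[OF _ _ tendsto_const lim0])
      have "dist (Y (Suc (s j))) p \<le> dist (Y (s j)) p + c3 * D (s j)" for j
        using dist_triangle[of "Y (Suc (s j))" p "Y (s j)"] step[of "s j"] by linarith
      then show "\<forall>\<^sub>F j in sequentially. dist (Y (Suc (s j))) p \<le> dist (Y (s j)) p + c3 * D (s j)" by auto
    qed auto
    then show "((\<lambda>k. Y (Suc k)) \<circ> s) \<longlonglongrightarrow> p"
      unfolding o_def by (rule tendsto_dist_iff[THEN iffD2])
  next
    show "0 \<le> \<Phi> k" for k using D[of k] K c by (simp add: \<Phi>_def)
  qed (use r s \<Phi>_lim in auto)
  then obtain n where n: "\<And>k. k \<ge> n \<Longrightarrow> dist (Y (Suc k)) p < r \<and> dist (Y (Suc k)) p \<le> \<Phi> k" by blast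
  have "dist (Y (Suc k)) p \<le> (c3 * (1 + K)) * (D k + E (Suc k) powr (1 - \<theta>)) \<and>
            (0 < E (Suc k) \<longrightarrow> E (Suc k) powr \<theta> \<le> C * D k)" if "k \<ge> max n n0" for k
  proof -
    have "D k + K * E (Suc k) powr (1 - \<theta>) \<le> (1 + K) * (D k + E (Suc k) powr (1 - \<theta>))"
      using K D[of k] by (simp add: algebra_simps)
    then have "\<Phi> k \<le> c3 * ((1 + K) * (D k + E (Suc k) powr (1 - \<theta>)))"
      unfolding \<Phi>_def using c by (intro mult_left_mono) auto
    then have "dist (Y (Suc k)) p \<le> (c3 * (1 + K)) * (D k + E (Suc k) powr (1 - \<theta>))"
      using n[of k] that by (simp add: mult.assoc)
    then show ?thesis using KL n[of k] n0[of k] that by auto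
  qed
  moreover have "c3 * (1 + K) > 0" using c K by simp
  ultimately show ?thesis using D_lim by blast
qed

text \<open>The distance to the limit is bounded by a power of the energy, and squaring the Kurdyka-Lojasiewicz inequality
  gives a recursion for the energy alone. For \<open>\<theta> \<le> 1/2\<close> the recursion contracts, for \<open>\<theta> > 1/2\<close> it is the one of
  \<open>sublinear_decay\<close>, and for \<open>\<theta> = 0\<close> a positive energy would keep the steps away from \<open>0\<close>.\<close>

lemma kl_descent_rates:
  fixes Y :: "nat \<Rightarrow> 'a::metric_space" and D E :: "nat \<Rightarrow> real"
  assumes D: "\<And>k. 0 \<le> D k" and E0: "\<And>k. 0 \<le> E k" and E: "E \<longlonglongrightarrow> 0"
    and c: "c1 > 0" "c3 > 0" "C > 0" and r: "r > 0" and \<nu>: "\<nu> > 0" and \<theta>: "0 \<le> \<theta>" "\<theta> < 1"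
    and descent: "\<And>k. c1 * (D k)\<^sup>2 \<le> E k - E (Suc k)"
    and step: "\<And>k. dist (Y (Suc k)) (Y k) \<le> c3 * D k"
    and s: "strict_mono s" "(Y \<circ> s) \<longlonglongrightarrow> p"
    and KL: "\<And>k. dist (Y (Suc k)) p < r \<Longrightarrow> 0 < E (Suc k) \<Longrightarrow> E (Suc k) < \<nu> \<Longrightarrow>
               E (Suc k) powr \<theta> \<le> C * D k"
  shows "Y \<longlonglongrightarrow> p"
    and "\<theta> = 0 \<Longrightarrow> \<exists>k0. \<forall>k\<ge>k0. Y k = p"
    and "\<theta> \<le> 1 / 2 \<Longrightarrow> \<exists>k0 c \<tau>. c > 0 \<and> 0 < \<tau> \<and> \<tau> < 1 \<and> (\<forall>k\<ge>k0. dist (Y k) p \<le> c * \<tau> ^ k)"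
    and "1 / 2 < \<theta> \<Longrightarrow> \<exists>k0 c. c > 0 \<and> (\<forall>k\<ge>k0. dist (Y k) p \<le> c * real k powr (- ((1 - \<theta>) / (2 * \<theta> - 1))))"
proof -
  obtain N0 K where K: "K > 0" and D_lim: "D \<longlonglongrightarrow> 0"
    and dist0: "\<And>k. k \<ge> N0 \<Longrightarrow> dist (Y (Suc k)) p \<le> K * (D k + E (Suc k) powr (1 - \<theta>))"
    and KL0: "\<And>k. k \<ge> N0 \<Longrightarrow> 0 < E (Suc k) \<Longrightarrow> E (Suc k) powr \<theta> \<le> C * D k"
    using kl_descent_distance[OF D E0 E c r \<nu> \<theta> descent step s KL] by blast
  have E_Suc: "(\<lambda>k. E (Suc k)) \<longlonglongrightarrow> 0" using E by (rule LIMSEQ_Suc)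
  have "(\<lambda>k. E (Suc k) powr (1 - \<theta>)) \<longlonglongrightarrow> 0 powr (1 - \<theta>)"
    using E_Suc \<theta> E0 by (intro tendsto_powr') auto
  then have lim0: "(\<lambda>k. K * (D k + E (Suc k) powr (1 - \<theta>))) \<longlonglongrightarrow> K * (0 + 0)"
    using D_lim \<theta> by (intro tendsto_intros) auto
  have "(\<lambda>k. dist (Y (Suc k)) p) \<longlonglongrightarrow> 0"
  proof (rule real_tendsto_sandwich[OF _ _ tendsto_const])
    show "\<forall>\<^sub>F k in sequentially. dist (Y (Suc k)) p \<le> K * (D k + E (Suc k) powr (1 - \<theta>))"
      using dist0 by (auto simp: eventually_sequentially)
  qed (use lim0 in auto)
  then have "(\<lambda>k. Y (Suc k)) \<longlonglongrightarrow> p" by (rule tendsto_dist_iff[THEN iffD2])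
  then show "Y \<longlonglongrightarrow> p" by (rule LIMSEQ_imp_Suc)

  have mono: "E (Suc k) \<le> E k" for k
  proof -
    have "0 \<le> c1 * (D k)\<^sup>2" using c by simp
    then show ?thesis using descent[of k] by linarith
  qed
  obtain N1 where "\<And>k. k \<ge> N1 \<Longrightarrow> E k < 1"
    using order_tendstoD(2)[OF E, of 1] by (auto simp: eventually_sequentially)
  then have N1: "E k \<le> 1" if "k \<ge> N1" for k using that less_imp_le by blast
  define N where "N = max N0 N1"
  \<comment> \<open>both terms of the distance bound are powers of the energy, and for \<open>E \<le> 1\<close> the smaller exponent dominates\<close>
  define \<kappa> where "\<kappa> = min (1/2) (1 - \<theta>)"
  have \<kappa>: "0 < \<kappa>" using \<theta> by (auto simp: \<kappa>_def)
  have \<kappa>_le: "\<kappa> \<le> 1/2" "\<kappa> \<le> 1 - \<theta>" unfolding \<kappa>_def by (rule min.cobounded1, rule min.cobounded2)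
  have D_le: "D k \<le> (E k / c1) powr (1/2)" for k
  proof -
    have "(D k)\<^sup>2 \<le> E k / c1" using descent[of k] E0[of "Suc k"] c by (simp add: field_simps)
    then have "sqrt ((D k)\<^sup>2) \<le> sqrt (E k / c1)" by (rule real_sqrt_le_mono)
    then show ?thesis using D[of k] E0[of k] c by (simp add: powr_half_sqrt)
  qed
  define K' where "K' = K * ((1 / c1) powr (1/2) + 1)"
  have K': "K' > 0" using K c by (simp add: K'_def add_pos_pos)
  have dist1: "dist (Y (Suc k)) p \<le> K' * E k powr \<kappa>" if "k \<ge> N" for k
  proof -
    have E1: "E k \<le> 1" using N1 that by (auto simp: N_def)
    have pw: "E k powr a \<le> E k powr \<kappa>" if "a \<ge> \<kappa>" for a
      by (rule powr_mono'[OF that E0 E1])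
    have "D k \<le> (1 / c1) powr (1/2) * E k powr (1/2)"
      using D_le[of k] c E0[of k] by (simp add: powr_divide)
    also have "\<dots> \<le> (1 / c1) powr (1/2) * E k powr \<kappa>"
      by (intro mult_left_mono pw \<kappa>_le) simp
    finally have "D k \<le> (1 / c1) powr (1/2) * E k powr \<kappa>" .
    moreover have "E (Suc k) powr (1 - \<theta>) \<le> E k powr \<kappa>"
      using mono[of k] E0 \<theta> by (intro order_trans[OF powr_mono2 pw[OF \<kappa>_le(2)]]) auto
    ultimately have "D k + E (Suc k) powr (1 - \<theta>) \<le> ((1 / c1) powr (1/2) + 1) * E k powr \<kappa>"
      by (simp add: algebra_simps)
    then have "K * (D k + E (Suc k) powr (1 - \<theta>)) \<le> K * (((1 / c1) powr (1/2) + 1) * E k powr \<kappa>)"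
      using K by (intro mult_left_mono) auto
    then show ?thesis using dist0[of k] that unfolding K'_def N_def by (simp add: mult.assoc)
  qed
  define B where "B = C\<^sup>2 / c1"
  have B: "B > 0" using c by (simp add: B_def)
  have rec: "E (Suc k) powr (2 * \<theta>) \<le> B * (E k - E (Suc k))" if "k \<ge> N" "0 < E (Suc k)" for k
  proof -
    have "(E (Suc k) powr \<theta>)\<^sup>2 \<le> (C * D k)\<^sup>2"
      using KL0[of k] that by (intro power_mono) (auto simp: N_def)
    also have "\<dots> = B * (c1 * (D k)\<^sup>2)" using c by (simp add: B_def power_mult_distrib)
    also have "\<dots> \<le> B * (E k - E (Suc k))" using descent B by (intro mult_left_mono) auto
    finally show ?thesis using that by (simp add: powr_power mult.commute)
  qed

  show "\<exists>k0. \<forall>k\<ge>k0. Y k = p" if "\<theta> = 0"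
  proof -
    \<comment> \<open>a positive \<open>E (k+1)\<close> would force \<open>D k \<ge> 1 / C\<close>\<close>
    obtain N2 where N2: "\<And>k. k \<ge> N2 \<Longrightarrow> D k < 1 / C"
      using order_tendstoD(2)[OF D_lim, of "1 / C"] c by (auto simp: eventually_sequentially)
    have E_zero: "E (Suc k) = 0" if "k \<ge> max N N2" for k
    proof (rule ccontr)
      assume "E (Suc k) \<noteq> 0"
      then have "E (Suc k) > 0" using E0[of "Suc k"] by simp
      with KL0[of k] that \<open>\<theta> = 0\<close> have "1 \<le> C * D k" by (simp add: N_def)
      with N2[of k] that c show False by (simp add: field_simps)
    qed
    have "Y k = p" if k: "k \<ge> Suc (Suc (max N N2))" for k
    proof -
      obtain j where j: "k = Suc (Suc j)" "j \<ge> max N N2" using k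
        by (intro that[of "k - 2"]) auto
      have "dist (Y (Suc (Suc j))) p \<le> K' * E (Suc j) powr \<kappa>" using j by (intro dist1) auto
      then show ?thesis using E_zero[OF j(2)] j by simp
    qed
    then show ?thesis by blast
  qed

  show "\<exists>k0 c \<tau>. c > 0 \<and> 0 < \<tau> \<and> \<tau> < 1 \<and> (\<forall>k\<ge>k0. dist (Y k) p \<le> c * \<tau> ^ k)" if th: "\<theta> \<le> 1/2"
  proof -
    \<comment> \<open>as eventually \<open>E \<le> 1\<close>, and as \<open>2 * \<theta> \<le> 1\<close>, the recursion implies \<open>E (k+1) \<le> B * (E k - E (k+1))\<close>\<close>
    define q where "q = B / (1 + B)"
    have q: "0 < q" "q < 1" using B by (auto simp: q_def)
    have E_step: "E (Suc k) \<le> q * E k" if "k \<ge> N" for k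
    proof (cases "E (Suc k) = 0")
      case False
      then have pos: "0 < E (Suc k)" using E0[of "Suc k"] by simp
      have "E (Suc k) \<le> 1" using N1 that by (auto simp: N_def)
      then have "E (Suc k) powr 1 \<le> E (Suc k) powr (2 * \<theta>)"
        using th pos by (intro powr_mono') auto
      then have "E (Suc k) \<le> B * (E k - E (Suc k))" using rec[OF that pos] pos by simp
      then show ?thesis using B by (simp add: q_def field_simps)
    qed (use q E0 in auto)
    have E_geo: "E (N + j) \<le> q ^ j" for j
    proof (induction j)
      case 0 then show ?case using N1[of N] by (simp add: N_def)
    next
      case (Suc j)
      have "E (N + Suc j) \<le> q * E (N + j)" using E_step[of "N + j"] by simp
      also have "\<dots> \<le> q * q ^ j" using Suc q by (intro mult_left_mono) auto
      finally show ?case by simp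
    qed
    define \<tau> where "\<tau> = q powr \<kappa>"
    have \<tau>: "0 < \<tau>" "\<tau> < 1" using q \<kappa> powr_less_mono2[of \<kappa> q 1] by (auto simp: \<tau>_def)
    have "dist (Y k) p \<le> (K' / \<tau> ^ (Suc N)) * \<tau> ^ k" if "k \<ge> Suc N" for k
    proof -
      have "k = Suc (N + (k - Suc N))" using that by simp
      then obtain j where j: "k = Suc (N + j)" by blast 
      have "dist (Y k) p \<le> K' * E (N + j) powr \<kappa>" unfolding j by (rule dist1) simp
      also have "\<dots> \<le> K' * (q ^ j) powr \<kappa>"
        using E_geo[of j] E0 \<kappa> K' by (intro mult_left_mono powr_mono2) auto
      also have "(q ^ j) powr \<kappa> = \<tau> ^ j"
        using q by (simp add: \<tau>_def powr_powr mult.commute flip: powr_realpow)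
      also have "K' * \<tau> ^ j = (K' / \<tau> ^ (Suc N)) * \<tau> ^ k"
        using \<tau> by (simp add: j power_add field_simps)
      finally show ?thesis .
    qed
    moreover have "K' / \<tau> ^ (Suc N) > 0" using K' \<tau> by simp
    ultimately show ?thesis using \<tau> by blast
  qed

  show "\<exists>k0 c. c > 0 \<and> (\<forall>k\<ge>k0. dist (Y k) p \<le> c * real k powr (- ((1 - \<theta>) / (2 * \<theta> - 1))))"
    if th: "1/2 < \<theta>"
  proof -
    have "\<exists>M>0. \<forall>j. E (N + j) \<le> M * real (Suc j) powr (- (1 / (2 * \<theta> - 1)))"
    proof (rule sublinear_decay)
      show "E (N + Suc j) powr (2 * \<theta>) \<le> B * (E (N + j) - E (N + Suc j))" for j
      proof (cases "E (N + Suc j) = 0")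
        case True then show ?thesis using E0[of "N + j"] B by simp
      next
        case False
        then show ?thesis using rec[of "N + j"] E0[of "N + Suc j"] by simp
      qed
    qed (use E0 B th in auto)
    then obtain M where M: "M > 0" "\<And>j. E (N + j) \<le> M * real (Suc j) powr (- (1 / (2 * \<theta> - 1)))"
      by blast
    define e where "e = (1 - \<theta>) / (2 * \<theta> - 1)"
    have e: "e > 0" using th \<theta> by (simp add: e_def)
    have \<kappa>_eq: "\<kappa> = 1 - \<theta>" using th by (simp add: \<kappa>_def)
    define c' where "c' = K' * M powr (1 - \<theta>) * 2 powr e"
    have c': "c' > 0" using K' M by (simp add: c'_def)
    have "dist (Y k) p \<le> c' * real k powr (- e)" if "k \<ge> 2 * N + 1" for k
    proof -
      have "k = Suc (N + (k - Suc N))" using that by simp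
      then obtain j where j: "k = Suc (N + j)" by blast
      have "dist (Y k) p \<le> K' * E (N + j) powr (1 - \<theta>)"
        unfolding j using dist1[of "N + j"] \<kappa>_eq by simp
      also have "\<dots> \<le> K' * (M * real (Suc j) powr (- (1 / (2 * \<theta> - 1)))) powr (1 - \<theta>)"
        using M E0 \<theta> K' by (intro mult_left_mono powr_mono2) auto
      also have "\<dots> = K' * M powr (1 - \<theta>) * real (Suc j) powr (- e)"
        using M by (simp add: powr_mult powr_powr e_def)
      also have "\<dots> \<le> K' * M powr (1 - \<theta>) * (real k / 2) powr (- e)"
        using K' e j that by (intro mult_left_mono powr_mono2') auto
      also have "(real k / 2) powr (- e) = 2 powr e * real k powr (- e)"
        by (rule powr_minus_half) simp
      finally show ?thesis by (simp add: c'_def mult.assoc)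
    qed
    then show ?thesis using c' unfolding e_def by blast
  qed
qed

section \<open>Gradients and quadratic remainders\<close>

lemma gradient_eqI:
  assumes "GDERIV q x :> v"
  shows "gradient q x = v"
  unfolding gradient_def
proof (rule the_equality, rule assms)
  fix a assume "GDERIV q x :> a"
  with assms have "(\<lambda>h. h \<bullet> a) = (\<lambda>h. h \<bullet> v)"
    unfolding gderiv_def by (rule has_derivative_unique[rotated])
  then have "(a - v) \<bullet> a = (a - v) \<bullet> v" by (rule fun_cong)
  then have "(a - v) \<bullet> (a - v) = 0" by (simp add: inner_diff_right)
  then show "a = v" by simp
qed

lemma GDERIV_gradient:
  fixes h :: "'a::euclidean_space \<Rightarrow> real"
  assumes "h differentiable (at x)"
  shows "GDERIV h x :> gradient h x"
proof -
  obtain f' where f': "(h has_derivative f') (at x)" using assms by (auto simp: differentiable_def)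
  then have "linear f'" by (rule has_derivative_linear)
  then have "f' = (\<lambda>u. u \<bullet> adjoint f' 1)"
    using adjoint_works[of f' _ 1] by (auto simp: fun_eq_iff)
  then have "GDERIV h x :> adjoint f' 1" using f' unfolding gderiv_def by simp
  then show ?thesis by (simp add: gradient_eqI)
qed

lemma GDERIV_quadratic_remainder:
  fixes f :: "'a::real_inner \<Rightarrow> real"
  assumes "\<And>d. \<bar>f (w + d) - f w - v \<bullet> d\<bar> \<le> K * (norm d)\<^sup>2"
  shows "GDERIV f w :> v"
  unfolding gderiv_def
proof (rule has_derivativeI_sandwich[of 1 _ _ _ _ "\<lambda>y. K * norm (y - w)"])
  show "bounded_linear (\<lambda>h. h \<bullet> v)" by (rule bounded_linear_inner_left)
  have "((\<lambda>y. K * norm (y - w)) \<longlongrightarrow> K * norm (w - w)) (at w)" by (intro tendsto_intros)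
  then show "((\<lambda>y. K * norm (y - w)) \<longlongrightarrow> 0) (at w)" by simp
  fix y assume "y \<noteq> w"
  moreover have "\<bar>f y - f w - (y - w) \<bullet> v\<bar> \<le> K * (norm (y - w))\<^sup>2"
    using assms[of "y - w"] by (simp add: inner_commute)
  ultimately show "norm (f y - f w - (y - w) \<bullet> v) / norm (y - w) \<le> K * norm (y - w)"
    by (simp add: divide_le_eq power2_eq_square mult.assoc)
qed simp

text \<open>Along the segment from \<open>y\<close> to \<open>u\<close> the derivative of the remainder is at most \<open>L * t * \<parallel>u - y\<parallel>\<^sup>2\<close> in absolute
  value, so adding or subtracting \<open>L / 2 * t\<^sup>2 * \<parallel>u - y\<parallel>\<^sup>2\<close> makes the remainder monotone.\<close>

lemma lipschitz_gradient_quadratic_bound: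
  fixes h :: "'a::euclidean_space \<Rightarrow> real"
  assumes diff: "\<And>u. h differentiable (at u)" and lip: "L-lipschitz_on UNIV (gradient h)"
  shows "\<bar>h u - h y - gradient h y \<bullet> (u - y)\<bar> \<le> L / 2 * (norm (u - y))\<^sup>2"
proof -
  define d where "d = u - y"
  have L: "L \<ge> 0" using lip by (rule lipschitz_on_nonneg)
  have der: "((\<lambda>t. h (y + t *\<^sub>R d)) has_real_derivative gradient h (y + t *\<^sub>R d) \<bullet> d) (at t)" for t
  proof -
    have "((\<lambda>t. h (y + t *\<^sub>R d)) has_derivative (\<lambda>s. (s *\<^sub>R d) \<bullet> gradient h (y + t *\<^sub>R d))) (at t)"
    proof (rule has_derivative_compose[where f = "\<lambda>t. y + t *\<^sub>R d"])
      show "((\<lambda>t. y + t *\<^sub>R d) has_derivative (\<lambda>s. s *\<^sub>R d)) (at t)"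
        by (auto intro!: derivative_eq_intros)
      show "(h has_derivative (\<lambda>k. k \<bullet> gradient h (y + t *\<^sub>R d))) (at (y + t *\<^sub>R d))"
        using GDERIV_gradient[OF diff] unfolding gderiv_def .
    qed
    then show ?thesis
      unfolding has_field_derivative_def
      by (rule has_derivative_eq_rhs) (auto simp: inner_commute mult.commute)
  qed
  have lip_d: "\<bar>(gradient h (y + t *\<^sub>R d) - gradient h y) \<bullet> d\<bar> \<le> L * t * (norm d)\<^sup>2" if "t \<ge> 0" for t
  proof -
    have "\<bar>(gradient h (y + t *\<^sub>R d) - gradient h y) \<bullet> d\<bar> \<le> norm (gradient h (y + t *\<^sub>R d) - gradient h y) * norm d"
      by (rule Cauchy_Schwarz_ineq2)
    also have "\<dots> \<le> (L * (t * norm d)) * norm d"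
      using lipschitz_onD[OF lip, of "y + t *\<^sub>R d" y] that
      by (intro mult_right_mono) (auto simp: dist_norm)
    finally show ?thesis by (simp add: power2_eq_square mult.assoc)
  qed
  have one_sided: "\<sigma> * (h u - h y - gradient h y \<bullet> d) \<le> L / 2 * (norm d)\<^sup>2" if \<sigma>: "\<bar>\<sigma>\<bar> = 1" for \<sigma> :: real
  proof -
    define \<psi> where "\<psi> t = \<sigma> * (h (y + t *\<^sub>R d) - t * (gradient h y \<bullet> d)) - L / 2 * (norm d)\<^sup>2 * t\<^sup>2" for t
    have "\<psi> 1 \<le> \<psi> 0"
    proof (rule DERIV_nonpos_imp_nonincreasing[of 0 1 \<psi>])
      fix t :: real assume t: "0 \<le> t" "t \<le> 1"
      have "(\<psi> has_real_derivative \<sigma> * (gradient h (y + t *\<^sub>R d) \<bullet> d - gradient h y \<bullet> d) - L / 2 * (norm d)\<^sup>2 * (2 * t)) (at t)"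
        unfolding \<psi>_def by (rule derivative_eq_intros der refl | simp)+
      moreover have "\<sigma> * (gradient h (y + t *\<^sub>R d) \<bullet> d - gradient h y \<bullet> d) \<le> L * t * (norm d)\<^sup>2"
        using lip_d[OF t(1)] \<sigma> by (auto simp: abs_if inner_diff_left split: if_splits)
      ultimately show "\<exists>D. (\<psi> has_real_derivative D) (at t) \<and> D \<le> 0"
        by (intro exI conjI) (assumption, simp add: mult.commute mult.left_commute)
    qed simp
    then show ?thesis by (simp add: \<psi>_def d_def algebra_simps)
  qed
  show ?thesis using one_sided[of 1] one_sided[of "-1"] by (simp add: d_def abs_if)
qed

section \<open>Proximal subgradients\<close>

text \<open>The global version of a proximal subgradient, with the quadratic constant made explicit because
  the arguments below compare different constants.\<close>

definition proximal_subgradient :: "real \<Rightarrow> ('a::real_inner \<Rightarrow> real) \<Rightarrow> 'a \<Rightarrow> 'a \<Rightarrow> bool" where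
  "proximal_subgradient C q y v \<longleftrightarrow> (\<forall>u. q y + v \<bullet> (u - y) - C * (norm (u - y))\<^sup>2 \<le> q u)"

lemma proximal_subgradientD:
  "proximal_subgradient C q y v \<Longrightarrow> q y + v \<bullet> (u - y) - C * (norm (u - y))\<^sup>2 \<le> q u"
  by (simp add: proximal_subgradient_def)

lemma proximal_subgradient_imp_limiting:
  assumes "proximal_subgradient C q y v"
  shows "v \<in> limiting_subdiff q y"
proof -
  have "0 \<le> Liminf (at y) (\<lambda>u. ereal ((q u - q y - v \<bullet> (u - y)) / norm (y - u)))"
    unfolding le_Liminf_iff
  proof (intro allI impI)
    fix b :: ereal assume "b < 0"
    have "((\<lambda>u. - C * norm (y - u)) \<longlongrightarrow> - C * norm (y - y)) (at y)" by (intro tendsto_intros)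
    then have "((\<lambda>u. ereal (- C * norm (y - u))) \<longlongrightarrow> ereal 0) (at y)"
      by (intro tendsto_ereal) simp
    then have "\<forall>\<^sub>F u in at y. b < ereal (- C * norm (y - u))"
      using \<open>b < 0\<close> by (intro order_tendstoD) (auto simp: zero_ereal_def)
    moreover have "\<forall>\<^sub>F u in at y. u \<noteq> y" by (auto simp: eventually_at_filter)
    ultimately show "\<forall>\<^sub>F u in at y. b < ereal ((q u - q y - v \<bullet> (u - y)) / norm (y - u))"
    proof eventually_elim
      case (elim u)
      have "- C * norm (y - u) \<le> (q u - q y - v \<bullet> (u - y)) / norm (y - u)"
        using proximal_subgradientD[OF assms, of u] elim
        by (simp add: le_divide_eq power2_eq_square norm_minus_commute mult.assoc)
      then show ?case using elim by (meson ereal_less_eq(3) less_le_trans)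
    qed
  qed
  then have "v \<in> frechet_subdiff q y" by (simp add: frechet_subdiff_def)
  then show ?thesis
    unfolding limiting_subdiff_def
    by (intro CollectI exI[of _ "\<lambda>_. y"] exI[of _ "\<lambda>_. v"]) auto
qed

text \<open>On a convex function a supporting parabola can be replaced by its tangent: moving a fraction \<open>t\<close> of
  the way towards \<open>u\<close> multiplies the quadratic error by \<open>t\<^sup>2\<close> and the linear term by \<open>t\<close>, while the increment of
  the function is at most \<open>t\<close> times its increment up to \<open>u\<close>. Divide by \<open>t\<close> and let \<open>t\<close> tend to \<open>0\<close>.\<close>

lemma proximal_subgradient_of_convex:
  assumes "convex_on UNIV q" "proximal_subgradient C q y v"
  shows "proximal_subgradient 0 q y v"
  unfolding proximal_subgradient_def
proof
  fix u
  have le: "v \<bullet> (u - y) - C * t * (norm (u - y))\<^sup>2 \<le> q u - q y" if t: "0 < t" "t \<le> 1" for t :: real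
  proof -
    have "q y + v \<bullet> (t *\<^sub>R (u - y)) - C * (norm (t *\<^sub>R (u - y)))\<^sup>2 \<le> q (y + t *\<^sub>R (u - y))"
      using proximal_subgradientD[OF assms(2), of "y + t *\<^sub>R (u - y)"] by simp
    also have "y + t *\<^sub>R (u - y) = (1 - t) *\<^sub>R y + t *\<^sub>R u" by (simp add: algebra_simps)
    also have "q \<dots> \<le> (1 - t) * q y + t * q u"
      using t by (intro convex_onD[OF assms(1)]) auto
    finally have "q y + t * (v \<bullet> (u - y)) - C * (t\<^sup>2 * (norm (u - y))\<^sup>2) \<le> (1 - t) * q y + t * q u"
      by (simp add: power_mult_distrib)
    moreover have "t * (v \<bullet> (u - y) - C * t * (norm (u - y))\<^sup>2) =
        t * (v \<bullet> (u - y)) - C * (t\<^sup>2 * (norm (u - y))\<^sup>2)"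
      by (simp add: right_diff_distrib power2_eq_square)
    moreover have "t * (q u - q y) = (1 - t) * q y + t * q u - q y" by (simp add: algebra_simps)
    ultimately have "t * (v \<bullet> (u - y) - C * t * (norm (u - y))\<^sup>2) \<le> t * (q u - q y)" by linarith
    then show ?thesis using t by simp
  qed
  have "v \<bullet> (u - y) \<le> q u - q y"
  proof (rule tendsto_upperbound)
    have "((\<lambda>t. v \<bullet> (u - y) - C * t * (norm (u - y))\<^sup>2) \<longlongrightarrow> v \<bullet> (u - y) - C * 0 * (norm (u - y))\<^sup>2) (at_right 0)"
      by (intro tendsto_intros)
    then show "((\<lambda>t. v \<bullet> (u - y) - C * t * (norm (u - y))\<^sup>2) \<longlongrightarrow> v \<bullet> (u - y)) (at_right 0)" by simp
    show "\<forall>\<^sub>F t in at_right 0. v \<bullet> (u - y) - C * t * (norm (u - y))\<^sup>2 \<le> q u - q y"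
      unfolding eventually_at_right_field by (intro exI[of _ 1]) (auto intro: le)
  qed simp
  then show "q y + v \<bullet> (u - y) - 0 * (norm (u - y))\<^sup>2 \<le> q u" by simp
qed

text \<open>The quadratic that makes \<open>q\<close> convex turns the minorant into a tangent, and taking it away again leaves
  the constant \<open>\<rho> / 2\<close>. Thus the constant no longer depends on how the subgradient was found.\<close>

lemma proximal_subgradient_of_weakly_convex:
  assumes wc: "weakly_convex \<rho> q" and v: "proximal_subgradient C q y v"
  shows "proximal_subgradient (\<rho> / 2) q y v"
proof -
  let ?\<phi> = "\<lambda>u. q u + \<rho> / 2 * (norm u)\<^sup>2"
  have sq: "(norm u)\<^sup>2 = (norm y)\<^sup>2 + 2 * (y \<bullet> (u - y)) + (norm (u - y))\<^sup>2" for u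
    by (simp add: power2_norm_eq_inner inner_diff_left inner_diff_right inner_commute)
  have "proximal_subgradient (C - \<rho> / 2) ?\<phi> y (v + \<rho> *\<^sub>R y)"
    unfolding proximal_subgradient_def
  proof
    fix u show "?\<phi> y + (v + \<rho> *\<^sub>R y) \<bullet> (u - y) - (C - \<rho> / 2) * (norm (u - y))\<^sup>2 \<le> ?\<phi> u"
      using proximal_subgradientD[OF v, of u] unfolding sq[of u]
      by (simp add: inner_add_left algebra_simps)
  qed
  moreover have "convex_on UNIV ?\<phi>" using wc by (simp add: weakly_convex_def)
  ultimately have "proximal_subgradient 0 ?\<phi> y (v + \<rho> *\<^sub>R y)"
    by (rule proximal_subgradient_of_convex[rotated])
  note minorant = proximal_subgradientD[OF this]
  show ?thesis
    unfolding proximal_subgradient_def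
  proof
    fix u show "q y + v \<bullet> (u - y) - \<rho> / 2 * (norm (u - y))\<^sup>2 \<le> q u"
      using minorant[of u] unfolding sq[of u]
      by (simp add: inner_add_left algebra_simps)
  qed
qed

lemma continuous_weakly_convex:
  fixes q :: "'a::euclidean_space \<Rightarrow> real"
  assumes "weakly_convex \<rho> q"
  shows "continuous_on UNIV q"
proof -
  have "continuous_on UNIV (\<lambda>u. q u + \<rho> / 2 * (norm u)\<^sup>2)"
    using assms by (intro convex_on_continuous) (auto simp: weakly_convex_def)
  then have "continuous_on UNIV (\<lambda>u. (q u + \<rho> / 2 * (norm u)\<^sup>2) - \<rho> / 2 * (norm u)\<^sup>2)"
    by (rule continuous_on_diff) (intro continuous_intros)
  then show ?thesis by simp
qed

section \<open>Proximal maps and Moreau envelopes\<close>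

text \<open>The lower bound behind both parts of \<open>prox_at_subgradient_step\<close>: around \<open>y + \<gamma> *\<^sub>R v\<close> the objective of the
  proximal map is at least its value at \<open>y\<close> plus a strongly convex term, up to a cross term with the shift \<open>d\<close> of the centre.\<close>

lemma prox_objective_minorant:
  assumes v: "proximal_subgradient (\<rho> / 2) q y v" and \<gamma>: "\<gamma> > 0"
  shows "q y + \<gamma> / 2 * (norm v)\<^sup>2 + v \<bullet> d + (norm d)\<^sup>2 / (2 * \<gamma>) + (1 / \<gamma> - \<rho>) / 2 * (norm (u - y))\<^sup>2
           - (u - y) \<bullet> d / \<gamma>
         \<le> q u + 1 / (2 * \<gamma>) * (norm (u - (y + \<gamma> *\<^sub>R v + d)))\<^sup>2"
proof -
  define e where "e = u - y"
  have "u - (y + \<gamma> *\<^sub>R v + d) = e - \<gamma> *\<^sub>R v - d" by (simp add: e_def)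
  then have "(norm (u - (y + \<gamma> *\<^sub>R v + d)))\<^sup>2 =
      (norm e)\<^sup>2 + \<gamma>\<^sup>2 * (norm v)\<^sup>2 + (norm d)\<^sup>2 - 2 * \<gamma> * (v \<bullet> e) - 2 * (e \<bullet> d) + 2 * \<gamma> * (v \<bullet> d)"
    unfolding power2_norm_eq_inner
    by (simp add: inner_diff_left inner_diff_right inner_commute power2_eq_square algebra_simps)
  then have "1 / (2 * \<gamma>) * (norm (u - (y + \<gamma> *\<^sub>R v + d)))\<^sup>2 =
      (norm e)\<^sup>2 / (2 * \<gamma>) + \<gamma> / 2 * (norm v)\<^sup>2 + (norm d)\<^sup>2 / (2 * \<gamma>) - v \<bullet> e - e \<bullet> d / \<gamma> + v \<bullet> d"
    using \<gamma> by (simp only:) (simp add: field_simps power2_eq_square)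
  moreover have "q y + v \<bullet> e - \<rho> / 2 * (norm e)\<^sup>2 \<le> q u"
    using proximal_subgradientD[OF v, of u] by (simp add: e_def)
  moreover have "(1 / \<gamma> - \<rho>) / 2 * (norm e)\<^sup>2 = (norm e)\<^sup>2 / (2 * \<gamma>) - \<rho> / 2 * (norm e)\<^sup>2"
    using \<gamma> by (simp add: field_simps)
  ultimately show ?thesis unfolding e_def[symmetric] by linarith
qed

text \<open>This turns an arbitrary subgradient \<open>v\<close> at \<open>y\<close> into a gradient of the Moreau envelope, so that the
  implicit Lipschitz property applies to it. Testing the infimum with \<open>y\<close> bounds the envelope from above, and
  the strongly convex minorant bounds it from below, both up to a quadratic error in the shift.\<close>

lemma prox_at_subgradient_step:
  assumes v: "proximal_subgradient (\<rho> / 2) q y v" and \<gamma>: "0 < \<gamma>" "\<gamma> < 1 / \<rho>" and \<rho>: "\<rho> > 0"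
  shows "prox \<gamma> q (y + \<gamma> *\<^sub>R v) = y"
    and "gradient (moreau_env \<gamma> q) (y + \<gamma> *\<^sub>R v) = v"
proof -
  define \<kappa> where "\<kappa> = 1 / \<gamma> - \<rho>"
  have \<kappa>: "\<kappa> > 0" using \<gamma> \<rho> by (simp add: \<kappa>_def field_simps)
  define w where "w = y + \<gamma> *\<^sub>R v"
  define F where "F d u = q u + 1 / (2 * \<gamma>) * (norm (u - (w + d)))\<^sup>2" for d u
  have env: "moreau_env \<gamma> q (w + d) = (INF u. F d u)" for d
    by (simp add: moreau_env_def F_def)
  have Fy: "F d y = q y + \<gamma> / 2 * (norm v)\<^sup>2 + v \<bullet> d + (norm d)\<^sup>2 / (2 * \<gamma>)" for d
  proof -
    have "(norm (y - (w + d)))\<^sup>2 = \<gamma>\<^sup>2 * (norm v)\<^sup>2 + (norm d)\<^sup>2 + 2 * \<gamma> * (v \<bullet> d)"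
      unfolding w_def power2_norm_eq_inner
      by (simp add: inner_diff_left inner_diff_right inner_add_left inner_add_right inner_commute power2_eq_square algebra_simps)
    then show ?thesis using \<gamma> by (simp add: F_def field_simps power2_eq_square)
  qed
  have F_ge: "F d y + \<kappa> / 2 * (norm (u - y))\<^sup>2 - (u - y) \<bullet> d / \<gamma> \<le> F d u" for d u
    using prox_objective_minorant[OF v \<gamma>(1), of d u] unfolding Fy
    by (simp add: F_def w_def \<kappa>_def)
  have F0: "F 0 y + \<kappa> / 2 * (norm (u - y))\<^sup>2 \<le> F 0 u" for u using F_ge[of 0 u] by simp
  have min0: "F 0 y \<le> F 0 u" for u
  proof -
    have "0 \<le> \<kappa> / 2 * (norm (u - y))\<^sup>2" using \<kappa> by simp
    then show ?thesis using F0[of u] by linarith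
  qed
  have "F 0 (arg_min (F 0) (\<lambda>_. True)) = F 0 y"
    using min0 by (intro arg_min_equality) auto
  then have "\<kappa> / 2 * (norm (arg_min (F 0) (\<lambda>_. True) - y))\<^sup>2 \<le> 0"
    using F0[of "arg_min (F 0) (\<lambda>_. True)"] by simp
  then have "arg_min (F 0) (\<lambda>_. True) = y" using \<kappa> by (simp add: mult_le_0_iff)
  moreover have "F 0 = (\<lambda>x. q x + 1 / (2 * \<gamma>) * (norm (x - (y + \<gamma> *\<^sub>R v)))\<^sup>2)"
    by (simp add: F_def w_def fun_eq_iff)
  ultimately show "prox \<gamma> q (y + \<gamma> *\<^sub>R v) = y" by (simp only: prox_def)

  have lower: "F d y - (norm d)\<^sup>2 / (2 * \<gamma>\<^sup>2 * \<kappa>) \<le> F d u" for d u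
  proof -
    \<comment> \<open>the cross term is absorbed by the strongly convex term, by completing the square\<close>
    have "(u - y) \<bullet> d \<le> norm (u - y) * norm d" by (rule norm_cauchy_schwarz)
    then have "(u - y) \<bullet> d / \<gamma> \<le> norm (u - y) * (norm d / \<gamma>)"
      using \<gamma> by (simp add: divide_right_mono)
    moreover have "norm (u - y) * (norm d / \<gamma>) \<le> \<kappa> / 2 * (norm (u - y))\<^sup>2 + (norm d)\<^sup>2 / (2 * \<gamma>\<^sup>2 * \<kappa>)"
    proof -
      have "0 \<le> (\<kappa> * norm (u - y) - norm d / \<gamma>)\<^sup>2 / (2 * \<kappa>)" using \<kappa> by simp
      also have "\<dots> = \<kappa> / 2 * (norm (u - y))\<^sup>2 + (norm d)\<^sup>2 / (2 * \<gamma>\<^sup>2 * \<kappa>) - norm (u - y) * (norm d / \<gamma>)"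
        using \<kappa> \<gamma> by (simp add: power2_eq_square field_simps)
      finally show ?thesis by simp
    qed
    ultimately show ?thesis using F_ge[of d u] by linarith
  qed
  have env_le: "moreau_env \<gamma> q (w + d) \<le> F d y" for d
    unfolding env by (rule cINF_lower) (use lower in \<open>auto intro!: bdd_belowI2\<close>)
  have env_ge: "F d y - (norm d)\<^sup>2 / (2 * \<gamma>\<^sup>2 * \<kappa>) \<le> moreau_env \<gamma> q (w + d)" for d
    unfolding env by (rule cINF_greatest) (use lower in auto)
  have env0: "moreau_env \<gamma> q w = F 0 y" using env_le[of 0] env_ge[of 0] by simp
  have "GDERIV (moreau_env \<gamma> q) w :> v"
  proof (rule GDERIV_quadratic_remainder)
    fix d :: 'a
    have p: "0 \<le> (norm d)\<^sup>2 / (2 * \<gamma>)" "0 \<le> (norm d)\<^sup>2 / (2 * \<gamma>\<^sup>2 * \<kappa>)" using \<gamma> \<kappa> by simp_all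
    have "\<bar>moreau_env \<gamma> q (w + d) - moreau_env \<gamma> q w - v \<bullet> d\<bar> \<le> (norm d)\<^sup>2 / (2 * \<gamma>) + (norm d)\<^sup>2 / (2 * \<gamma>\<^sup>2 * \<kappa>)"
      using env_le[of d] env_ge[of d] Fy[of d] Fy[of 0] env0 p by (simp add: abs_le_iff)
    then show "\<bar>moreau_env \<gamma> q (w + d) - moreau_env \<gamma> q w - v \<bullet> d\<bar> \<le> (1 / (2 * \<gamma>) + 1 / (2 * \<gamma>\<^sup>2 * \<kappa>)) * (norm d)\<^sup>2"
      by (simp add: algebra_simps)
  qed
  then show "gradient (moreau_env \<gamma> q) (y + \<gamma> *\<^sub>R v) = v"
    unfolding w_def by (rule gradient_eqI)
qed

lemma implicit_lipschitz_subgradientD: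
  assumes "implicit_lipschitz_subgradient \<rho> q L" and \<gamma>: "0 < \<gamma>" "\<gamma> < 1 / \<rho>" and \<rho>: "\<rho> > 0"
    and v: "proximal_subgradient (\<rho> / 2) q y v" and v': "proximal_subgradient (\<rho> / 2) q y' v'"
  shows "norm (v - v') \<le> L \<gamma> * norm (y - y')"
proof -
  note p = prox_at_subgradient_step[OF v \<gamma> \<rho>] and p' = prox_at_subgradient_step[OF v' \<gamma> \<rho>]
  have "y \<in> range (prox \<gamma> q)" "y' \<in> range (prox \<gamma> q)" using p(1) p'(1) by (metis rangeI)+
  then have "norm (gradient (moreau_env \<gamma> q) (y + \<gamma> *\<^sub>R v) - gradient (moreau_env \<gamma> q) (y' + \<gamma> *\<^sub>R v'))
      \<le> L \<gamma> * norm (y - y')"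
    using assms(1) \<gamma> p(1) p'(1) unfolding implicit_lipschitz_subgradient_def by blast
  then show ?thesis using p(2) p'(2) by simp
qed

section \<open>The smallest positive eigenvalue of a Gram matrix\<close>

lemma inner_transpose_mult:
  fixes A :: "real^'n^'m"
  shows "(transpose A *v w) \<bullet> u = w \<bullet> (A *v u)"
  by (simp add: transpose_matrix_vector dot_lmul_matrix)

text \<open>Eigenvectors of a symmetric matrix for different eigenvalues are orthogonal, hence independent.
  Finiteness ensures that the minimum in \<^const>\<open>min_pos_eigenvalue\<close> is a lower bound.\<close>

lemma finite_real_eigenvalues_gram:
  fixes A :: "real^'n^'m"
  shows "finite {s. real_eigenvalue (transpose A ** A) s}"
proof -
  let ?M = "transpose A ** A"
  let ?S = "{s. real_eigenvalue ?M s}"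
  have "\<forall>s\<in>?S. \<exists>v. v \<noteq> 0 \<and> ?M *v v = s *\<^sub>R v" by (simp add: real_eigenvalue_def)
  then obtain e where e: "\<And>s. s \<in> ?S \<Longrightarrow> e s \<noteq> 0 \<and> ?M *v e s = s *\<^sub>R e s" by metis
  have sym: "(?M *v u) \<bullet> w = u \<bullet> (?M *v w)" for u w
  proof -
    have "(?M *v u) \<bullet> w = (A *v u) \<bullet> (A *v w)" for u w
      by (simp only: inner_transpose_mult flip: matrix_vector_mul_assoc)
    then show ?thesis by (metis inner_commute)
  qed
  have orth: "e s \<bullet> e t = 0" if "s \<in> ?S" "t \<in> ?S" "s \<noteq> t" for s t
    using sym[of "e s" "e t"] e that by auto
  have inj: "inj_on e ?S"
    using orth e by (intro inj_onI) (metis inner_eq_zero_iff)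
  have "pairwise orthogonal (e ` ?S)"
    using orth by (auto simp: pairwise_def orthogonal_def)
  moreover have "0 \<notin> e ` ?S" using e by force
  ultimately have "independent (e ` ?S)" by (rule pairwise_orthogonal_independent)
  then have "finite (e ` ?S)" using independent_bound by blast
  then show ?thesis using inj by (rule finite_imageD)
qed

text \<open>Minimize \<open>\<parallel>A\<^sup>T w\<parallel>\<^sup>2\<close> over the unit sphere of the range of \<open>A\<close>. The first variation at a minimizer \<open>v0\<close> with value \<open>\<mu>\<close>
  is \<open>A (A\<^sup>T v0) = \<mu> v0\<close>, so \<open>A\<^sup>T v0\<close> is an eigenvector of \<open>A\<^sup>T A\<close>. It is nonzero, as \<open>v0\<close> is a nonzero element of
  the range, and therefore \<open>\<mu>\<close> is one of the positive eigenvalues.\<close>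

lemma min_pos_eigenvalue_gram_bound:
  fixes A :: "real^'n^'m"
  assumes v: "v \<in> range ((*v) A)"
  shows "min_pos_eigenvalue (transpose A ** A) * (norm v)\<^sup>2 \<le> (norm (transpose A *v v))\<^sup>2"
proof (cases "v = 0")
  case False
  let ?R = "range ((*v) A)"
  let ?T = "\<lambda>w. transpose A *v w"
  have lin: "linear ((*v) A)" by (rule matrix_vector_mul_linear)
  have R: "subspace ?R" by (rule linear_subspace_image[OF lin subspace_UNIV])
  let ?K = "?R \<inter> sphere 0 1"
  have "compact ?K" using closed_subspace[OF R] by (intro closed_Int_compact) auto
  moreover have "(1 / norm v) *\<^sub>R v \<in> ?K"
    using False v R by (auto simp: subspace_scale simp del: image_iff)
  then have "?K \<noteq> {}" by blast
  moreover have "continuous_on ?K (\<lambda>w. (norm (?T w))\<^sup>2)"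
    by (intro continuous_intros linear_continuous_on_compose[of _ "\<lambda>w. w"] matrix_vector_mul_linear)
  ultimately obtain v0 where v0: "v0 \<in> ?K" and min: "\<And>w. w \<in> ?K \<Longrightarrow> (norm (?T v0))\<^sup>2 \<le> (norm (?T w))\<^sup>2"
    using continuous_attains_inf[of ?K "\<lambda>w. (norm (?T w))\<^sup>2"] by blast
  define \<mu> where "\<mu> = (norm (?T v0))\<^sup>2"
  have bound: "\<mu> * (norm w)\<^sup>2 \<le> (norm (?T w))\<^sup>2" if "w \<in> ?R" for w
  proof (cases "w = 0")
    case False
    then have "(1 / norm w) *\<^sub>R w \<in> ?K"
      using that R by (auto simp: subspace_scale simp del: image_iff)
    from min[OF this] have "\<mu> \<le> (norm (?T w) / norm w)\<^sup>2"
      by (simp add: \<mu>_def matrix_vector_mult_scaleR)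
    then show ?thesis using False by (simp add: power_divide field_simps)
  qed simp
  \<comment> \<open>vary \<open>v0\<close> in the direction of the residual \<open>w\<close> of the eigenvalue equation; \<open>w\<close> lies in the range of \<open>A\<close>\<close>
  define w where "w = A *v ?T v0 - \<mu> *\<^sub>R v0"
  have w: "w \<in> ?R" unfolding w_def using R v0 by (auto intro!: subspace_diff subspace_scale)
  have nv0: "v0 \<bullet> v0 = 1" using v0 by (simp add: dot_square_norm)
  have \<mu>_inner: "\<mu> = ?T v0 \<bullet> ?T v0" by (simp add: \<mu>_def power2_norm_eq_inner)
  have small: "2 * (w \<bullet> w) \<le> \<epsilon> * (?T w \<bullet> ?T w)" if "\<epsilon> > 0" for \<epsilon> :: real
  proof -
    have "v0 - \<epsilon> *\<^sub>R w \<in> ?R" using R v0 w by (intro subspace_diff subspace_scale) auto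
    from bound[OF this]
    have "\<mu> * ((v0 - \<epsilon> *\<^sub>R w) \<bullet> (v0 - \<epsilon> *\<^sub>R w)) \<le> (?T v0 - \<epsilon> *\<^sub>R ?T w) \<bullet> (?T v0 - \<epsilon> *\<^sub>R ?T w)"
      by (simp add: power2_norm_eq_inner matrix_vector_mult_diff_distrib matrix_vector_mult_scaleR)
    then have "\<mu> * (1 - 2 * \<epsilon> * (w \<bullet> v0) + \<epsilon> * \<epsilon> * (w \<bullet> w)) \<le>
        \<mu> - 2 * \<epsilon> * (?T w \<bullet> ?T v0) + \<epsilon> * \<epsilon> * (?T w \<bullet> ?T w)"
      using nv0 by (simp add: inner_diff_left inner_diff_right inner_commute \<mu>_inner algebra_simps)
    moreover have ww: "w \<bullet> w = ?T w \<bullet> ?T v0 - \<mu> * (w \<bullet> v0)"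
      by (subst (2) w_def) (simp only: inner_diff_right inner_transpose_mult inner_scaleR_right)
    moreover have "\<epsilon> * (2 * (w \<bullet> w)) = 2 * \<epsilon> * (?T w \<bullet> ?T v0) - \<mu> * (2 * \<epsilon> * (w \<bullet> v0))"
      unfolding ww by (simp add: right_diff_distrib)
    moreover have "\<mu> * (1 - 2 * \<epsilon> * (w \<bullet> v0) + \<epsilon> * \<epsilon> * (w \<bullet> w)) =
        \<mu> - \<mu> * (2 * \<epsilon> * (w \<bullet> v0)) + \<mu> * (\<epsilon> * \<epsilon> * (w \<bullet> w))"
      by (simp add: algebra_simps)
    moreover have "0 \<le> \<mu> * (\<epsilon> * \<epsilon> * (w \<bullet> w))" using \<mu>_def by simp
    ultimately have "\<epsilon> * (2 * (w \<bullet> w)) \<le> \<epsilon> * \<epsilon> * (?T w \<bullet> ?T w)" by linarith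
    then have "\<epsilon> * (2 * (w \<bullet> w)) \<le> \<epsilon> * (\<epsilon> * (?T w \<bullet> ?T w))" by (simp only: mult.assoc)
    then show ?thesis using that by simp
  qed
  have "2 * (w \<bullet> w) \<le> 0"
  proof (rule tendsto_lowerbound)
    have "((\<lambda>\<epsilon>. \<epsilon> * (?T w \<bullet> ?T w)) \<longlongrightarrow> 0 * (?T w \<bullet> ?T w)) (at_right 0)" by (intro tendsto_intros)
    then show "((\<lambda>\<epsilon>. \<epsilon> * (?T w \<bullet> ?T w)) \<longlongrightarrow> 0) (at_right 0)" by simp
    show "\<forall>\<^sub>F \<epsilon> in at_right 0. 2 * (w \<bullet> w) \<le> \<epsilon> * (?T w \<bullet> ?T w)"
      by (rule eventually_mono[OF eventually_at_right_less small])
  qed simp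
  then have "w \<bullet> w \<le> 0" by simp
  then have "w \<bullet> w = 0" using inner_ge_zero[of w] by linarith
  then have "w = 0" by simp
  then have eig: "A *v ?T v0 = \<mu> *\<^sub>R v0" by (simp add: w_def)
  obtain p where p: "v0 = A *v p" using v0 by auto
  have T0: "?T v0 \<noteq> 0"
  proof
    assume "?T v0 = 0"
    then have "v0 \<bullet> (A *v p) = 0" using inner_transpose_mult[of A v0 p] by simp
    then show False using p nv0 by simp
  qed
  then have "\<mu> > 0" by (simp add: \<mu>_def)
  moreover have "real_eigenvalue (transpose A ** A) \<mu>"
    unfolding real_eigenvalue_def
    using T0 eig by (intro exI[of _ "?T v0"]) (simp add: matrix_vector_mult_scaleR flip: matrix_vector_mul_assoc)
  ultimately have "min_pos_eigenvalue (transpose A ** A) \<le> \<mu>"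
    unfolding min_pos_eigenvalue_def
    by (intro Min_le) (auto intro: finite_subset[OF _ finite_real_eigenvalues_gram])
  then have "min_pos_eigenvalue (transpose A ** A) * (norm v)\<^sup>2 \<le> \<mu> * (norm v)\<^sup>2"
    by (intro mult_right_mono) auto
  also have "\<dots> \<le> (norm (?T v))\<^sup>2" by (rule bound[OF v])
  finally show ?thesis .
qed simp

section \<open>The augmented Lagrangian and the Lyapunov function\<close>

lemma norm_add_sq: "(norm (a + d))\<^sup>2 = (norm a)\<^sup>2 + 2 * (a \<bullet> d) + (norm d)\<^sup>2"
  for a d :: "'a::real_inner"
  by (simp add: power2_norm_eq_inner inner_add_left inner_add_right inner_commute)

lemma norm_sq_tangent: "c * (norm a)\<^sup>2 + 2 * c * (a \<bullet> d) \<le> c * (norm (a + d))\<^sup>2"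
  if "c \<ge> 0" for a d :: "'a::real_inner"
  using mult_nonneg_nonneg[OF that zero_le_power2[of "norm d"]]
  unfolding norm_add_sq by (simp add: distrib_left)

lemma norm_quintuple_le: "norm (a, b, c, d, e) \<le> norm a + norm b + norm c + norm d + norm e"
proof -
  have "norm (a, b, c, d, e) \<le> norm a + (norm b + (norm c + (norm d + norm e)))"
    by (intro order_trans[OF norm_Pair_le add_mono] order_refl norm_Pair_le)
  then show ?thesis by simp
qed

lemma sum3_sq_le: "(a + b + c)\<^sup>2 \<le> 3 * (a\<^sup>2 + b\<^sup>2 + c\<^sup>2)" for a b c :: real
proof -
  have "0 \<le> (a - b)\<^sup>2 + (b - c)\<^sup>2 + (a - c)\<^sup>2" by simp
  then show ?thesis by (simp add: power2_eq_square algebra_simps)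
qed

lemma sum4_sq_le: "(a + b + c + d)\<^sup>2 \<le> 4 * (a\<^sup>2 + b\<^sup>2 + c\<^sup>2 + d\<^sup>2)" for a b c d :: real
proof -
  have "0 \<le> (a - b)\<^sup>2 + (a - c)\<^sup>2 + (a - d)\<^sup>2 + (b - c)\<^sup>2 + (b - d)\<^sup>2 + (c - d)\<^sup>2" by simp
  then show ?thesis by (simp add: power2_eq_square algebra_simps)
qed

text \<open>The exact expansion in the first argument around \<open>y\<close>. If \<open>y\<close> is the new iterate, then \<open>l'\<close> is the new multiplier,
  and the linear term is the smooth part of the optimality condition.\<close>

lemma prox_aug_lagrangian_shift:
  fixes A :: "real^'n^'m"
  assumes l': "l' = l + \<beta> *\<^sub>R (A *v y - b)"
  shows "prox_aug_lagrangian q A b \<beta> \<gamma> u w l = prox_aug_lagrangian q A b \<beta> \<gamma> y w l + (q u - q y)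
    + (transpose A *v l' + (1 / \<gamma>) *\<^sub>R (y - w)) \<bullet> (u - y)
    + \<beta> / 2 * (norm (A *v (u - y)))\<^sup>2 + 1 / (2 * \<gamma>) * (norm (u - y))\<^sup>2"
proof -
  define d where "d = u - y"
  have u: "u - w = (y - w) + d" "A *v u - b = (A *v y - b) + A *v d"
    by (simp_all add: d_def matrix_vector_mult_diff_distrib)
  have "(transpose A *v l') \<bullet> d = l \<bullet> (A *v d) + \<beta> * ((A *v y - b) \<bullet> (A *v d))"
    unfolding inner_transpose_mult l' by (simp add: inner_add_left)
  then show ?thesis
    unfolding prox_aug_lagrangian_def aug_lagrangian_def u norm_add_sq d_def[symmetric]
    by (simp add: inner_add_right inner_add_left distrib_left)
qed

text \<open>Convex quadratic terms lie above their tangents, so they only contribute to the subgradient. The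
  bilinear term in the multiplier and the first argument is not convex, but its second-order part is
  bounded by a multiple of the squared distance.\<close>

lemma proximal_subgradient_P_limeal:
  fixes A :: "real^'n^'m"
  assumes g: "proximal_subgradient C\<^sub>g g x s" and h: "proximal_subgradient C\<^sub>h h x t"
    and pos: "\<beta> \<ge> 0" "\<gamma> > 0" "\<alpha> \<ge> 0" and C: "C\<^sub>g \<ge> 0" "C\<^sub>h \<ge> 0"
  shows "\<exists>C. proximal_subgradient C (P_limeal (\<lambda>u. h u + g u) A b \<beta> \<gamma> \<alpha> Lh) (x, z, l, x', z')
     (t + s + transpose A *v (l + \<beta> *\<^sub>R (A *v x - b)) + (1 / \<gamma>) *\<^sub>R (x - z) + (8 * \<alpha> * \<gamma>\<^sup>2 * Lh\<^sup>2) *\<^sub>R (x - x'),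
      (1 / \<gamma>) *\<^sub>R (z - x) + (8 * \<alpha>) *\<^sub>R (z - z'),
      A *v x - b,
      (8 * \<alpha> * \<gamma>\<^sup>2 * Lh\<^sup>2) *\<^sub>R (x' - x),
      (8 * \<alpha>) *\<^sub>R (z' - z))"
    (is "\<exists>C. proximal_subgradient C ?P ?y ?v")
proof -
  obtain B where B: "B > 0" "\<And>u. norm (A *v u) \<le> norm u * B"
    using bounded_linear.pos_bounded[OF matrix_vector_mul_bounded_linear[of A]] by blast
  have "proximal_subgradient (C\<^sub>g + C\<^sub>h + B) ?P ?y ?v"
    unfolding proximal_subgradient_def
  proof
    fix u :: "(real^'n) \<times> (real^'n) \<times> (real^'m) \<times> (real^'n) \<times> (real^'n)"
    obtain dx dz dl dx' dz' where u: "u = (x + dx, z + dz, l + dl, x' + dx', z' + dz')"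
    proof -
      obtain u1 u2 u3 u4 u5 where "u = (u1, u2, u3, u4, u5)" by (metis surj_pair)
      then show ?thesis using that[of "u1 - x" "u2 - z" "u3 - l" "u4 - x'" "u5 - z'"] by simp
    qed
    define r where "r = A *v x - b"
    define a where "a = A *v dx"
    define w where "w = 4 * \<alpha> * (\<gamma>\<^sup>2 * Lh\<^sup>2)"
    have w: "w \<ge> 0" using pos by (simp add: w_def)
    have G: "g x + s \<bullet> dx - C\<^sub>g * (norm dx)\<^sup>2 \<le> g (x + dx)"
      using proximal_subgradientD[OF g, of "x + dx"] by simp
    have H: "h x + t \<bullet> dx - C\<^sub>h * (norm dx)\<^sup>2 \<le> h (x + dx)"
      using proximal_subgradientD[OF h, of "x + dx"] by simp
    have Ax: "A *v (x + dx) - b = r + a" by (simp add: r_def a_def matrix_vector_right_distrib)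
    have bil: "(l + dl) \<bullet> (r + a) = l \<bullet> r + l \<bullet> a + dl \<bullet> r + dl \<bullet> a"
      by (simp add: inner_add_left inner_add_right)
    have quad: "\<beta> / 2 * (norm r)\<^sup>2 + \<beta> * (r \<bullet> a) \<le> \<beta> / 2 * (norm (r + a))\<^sup>2"
      using norm_sq_tangent[of "\<beta> / 2" r a] pos by simp
    have px: "1 / (2 * \<gamma>) * (norm (x - z))\<^sup>2 + (1 / \<gamma>) * ((x - z) \<bullet> dx - (x - z) \<bullet> dz)
        \<le> 1 / (2 * \<gamma>) * (norm (x + dx - (z + dz)))\<^sup>2"
      using norm_sq_tangent[of "1 / (2 * \<gamma>)" "x - z" "dx - dz"] pos
      by (simp add: inner_diff_right algebra_simps)
    have pz: "4 * \<alpha> * (norm (z - z'))\<^sup>2 + 8 * \<alpha> * ((z - z') \<bullet> dz - (z - z') \<bullet> dz')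
        \<le> 4 * \<alpha> * (norm (z + dz - (z' + dz')))\<^sup>2"
      using norm_sq_tangent[of "4 * \<alpha>" "z - z'" "dz - dz'"] pos
      by (simp add: inner_diff_right algebra_simps)
    have pxx: "w * (norm (x - x'))\<^sup>2 + 2 * w * ((x - x') \<bullet> dx - (x - x') \<bullet> dx')
        \<le> w * (norm (x + dx - (x' + dx')))\<^sup>2"
      using norm_sq_tangent[of w "x - x'" "dx - dx'"] w
      by (simp add: inner_diff_right algebra_simps)
    have "- (dl \<bullet> a) \<le> norm dl * norm a"
      using norm_cauchy_schwarz[of "- dl" a] by simp
    also have "\<dots> \<le> norm dl * (norm dx * B)" unfolding a_def by (intro mult_left_mono B) simp
    also have "\<dots> = B * (norm dl * norm dx)" by simp
    also have "\<dots> \<le> B * ((norm dl)\<^sup>2 + (norm dx)\<^sup>2)"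
    proof (intro mult_left_mono)
      have "0 \<le> (norm dl - norm dx)\<^sup>2 + (norm dl)\<^sup>2 + (norm dx)\<^sup>2" by simp
      then show "norm dl * norm dx \<le> (norm dl)\<^sup>2 + (norm dx)\<^sup>2"
        by (simp add: power2_eq_square algebra_simps)
    qed (use B in simp)
    finally have cross: "- (B * ((norm dl)\<^sup>2 + (norm dx)\<^sup>2)) \<le> dl \<bullet> a" by simp
    have n2: "(norm (u - ?y))\<^sup>2 = (norm dx)\<^sup>2 + (norm dz)\<^sup>2 + (norm dl)\<^sup>2 + (norm dx')\<^sup>2 + (norm dz')\<^sup>2"
      by (simp add: u power2_norm_eq_inner)
    have "C\<^sub>g * (norm dx)\<^sup>2 + C\<^sub>h * (norm dx)\<^sup>2 + B * ((norm dl)\<^sup>2 + (norm dx)\<^sup>2)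
        \<le> C\<^sub>g * (norm (u - ?y))\<^sup>2 + C\<^sub>h * (norm (u - ?y))\<^sup>2 + B * (norm (u - ?y))\<^sup>2"
    proof -
      have "(norm dx)\<^sup>2 \<le> (norm (u - ?y))\<^sup>2" "(norm dl)\<^sup>2 + (norm dx)\<^sup>2 \<le> (norm (u - ?y))\<^sup>2"
        unfolding n2 by simp_all
      then show ?thesis using C B by (intro add_mono mult_left_mono) simp_all
    qed
    then have err: "C\<^sub>g * (norm dx)\<^sup>2 + C\<^sub>h * (norm dx)\<^sup>2 + B * ((norm dl)\<^sup>2 + (norm dx)\<^sup>2)
        \<le> (C\<^sub>g + C\<^sub>h + B) * (norm (u - ?y))\<^sup>2" by (simp add: distrib_right)
    have adj: "(transpose A *v (l + \<beta> *\<^sub>R r)) \<bullet> dx = l \<bullet> a + \<beta> * (r \<bullet> a)"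
      by (simp only: inner_transpose_mult inner_add_left inner_scaleR_left a_def)
    have "?v \<bullet> (u - ?y) =
        t \<bullet> dx + s \<bullet> dx + (l \<bullet> a + \<beta> * (r \<bullet> a)) + (1 / \<gamma>) * ((x - z) \<bullet> dx) + 2 * w * ((x - x') \<bullet> dx)
        + ((1 / \<gamma>) * ((z - x) \<bullet> dz) + 8 * \<alpha> * ((z - z') \<bullet> dz)) + r \<bullet> dl
        + 2 * w * ((x' - x) \<bullet> dx') + 8 * \<alpha> * ((z' - z) \<bullet> dz')"
      unfolding u r_def[symmetric] diff_Pair add_diff_cancel_left' inner_Pair adj inner_add_left inner_scaleR_left
      by (simp add: w_def)
    also have "\<dots> = t \<bullet> dx + s \<bullet> dx + (l \<bullet> a + \<beta> * (r \<bullet> a)) + dl \<bullet> r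
        + (1 / \<gamma>) * ((x - z) \<bullet> dx - (x - z) \<bullet> dz) + 2 * w * ((x - x') \<bullet> dx - (x - x') \<bullet> dx')
        + 8 * \<alpha> * ((z - z') \<bullet> dz - (z - z') \<bullet> dz')"
      by (simp add: inner_diff_left inner_commute algebra_simps)
    finally have v: "?v \<bullet> (u - ?y) = \<dots>" .
    have Pu: "?P u = h (x + dx) + g (x + dx) + (l + dl) \<bullet> (r + a) + \<beta> / 2 * (norm (r + a))\<^sup>2
        + 1 / (2 * \<gamma>) * (norm (x + dx - (z + dz)))\<^sup>2
        + (4 * \<alpha> * (norm (z + dz - (z' + dz')))\<^sup>2 + w * (norm (x + dx - (x' + dx')))\<^sup>2)"
      unfolding u P_limeal_def prod.case prox_aug_lagrangian_def aug_lagrangian_def Ax w_def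
      by (simp add: distrib_left)
    have Py: "?P ?y = h x + g x + l \<bullet> r + \<beta> / 2 * (norm r)\<^sup>2 + 1 / (2 * \<gamma>) * (norm (x - z))\<^sup>2
        + (4 * \<alpha> * (norm (z - z'))\<^sup>2 + w * (norm (x - x'))\<^sup>2)"
      unfolding P_limeal_def prod.case prox_aug_lagrangian_def aug_lagrangian_def r_def w_def
      by (simp add: distrib_left)
    show "?P ?y + ?v \<bullet> (u - ?y) - (C\<^sub>g + C\<^sub>h + B) * (norm (u - ?y))\<^sup>2 \<le> ?P u"
      using G H quad px pz pxx cross err unfolding v Pu Py bil by linarith
  qed
  then show ?thesis ..
qed

section \<open>Estimates along the iteration\<close>

locale limeal_iteration =
  fixes A :: "real^'n^'m" and b :: "real^'m"
    and h g :: "real^'n \<Rightarrow> real"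
    and Lh \<rho> \<beta> \<gamma> \<eta> \<alpha> :: real
    and Lg :: "real \<Rightarrow> real"
    and x z :: "nat \<Rightarrow> real^'n" and l :: "nat \<Rightarrow> real^'m"
  assumes feasible: "{u. A *v u = b} \<noteq> {}"
    and h_diff: "\<And>u. h differentiable (at u)"
    and Lh: "Lh > 0" "Lh-lipschitz_on UNIV (gradient h)"
    and g_wc: "\<rho> > 0" "weakly_convex \<rho> g"
    and g_ils: "implicit_lipschitz_subgradient \<rho> g Lg"
    and \<beta>: "\<beta> > 0"
    and gen: "limeal h g A b \<beta> \<gamma> \<eta> x z l"
    and bdd: "bounded (range (\<lambda>k. (x k, z k, l k)))"
    and \<gamma>: "0 < \<gamma>" "\<gamma> < 1 / (\<rho> + Lh)"
    and \<eta>: "0 < \<eta>" "\<eta> < 2"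
    and \<alpha>_eq: "\<alpha> = (2 * \<beta> + \<gamma> * \<eta> * (1 - \<eta> / 2)) / (2 * c_const \<gamma> A * \<beta>\<^sup>2)"
    and \<alpha>: "0 < \<alpha>"
      "\<alpha> < min (1 / (8 * \<gamma>) * (2 / \<eta> - 1))
               ((1 - \<gamma> * (\<rho> + Lh)) / (8 * \<gamma> * ((1 + \<gamma> * Lg \<gamma>)\<^sup>2 + \<gamma>\<^sup>2 * Lh\<^sup>2)))"
begin

abbreviation P_aug :: "real^'n \<Rightarrow> real^'n \<Rightarrow> real^'m \<Rightarrow> real" where
  "P_aug \<equiv> prox_aug_lagrangian (\<lambda>u. h u + g u) A b \<beta> \<gamma>"

abbreviation P_lya :: "(real^'n) \<times> (real^'n) \<times> (real^'m) \<times> (real^'n) \<times> (real^'n) \<Rightarrow> real" where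
  "P_lya \<equiv> P_limeal (\<lambda>u. h u + g u) A b \<beta> \<gamma> \<alpha> Lh"

text \<open>The optimality condition of the \<open>x\<close>-update, solved for the subgradient of \<open>g\<close> at \<open>x (k+1)\<close>; the penalty
  term has been merged into the new multiplier.\<close>

definition g_sub :: "nat \<Rightarrow> real^'n" where
  "g_sub k = - (gradient h (x k) + transpose A *v l (Suc k) + (1 / \<gamma>) *\<^sub>R (x (Suc k) - z k))"

definition Y :: "nat \<Rightarrow> (real^'n) \<times> (real^'n) \<times> (real^'m) \<times> (real^'n) \<times> (real^'n)" where
  "Y k = (x (Suc k), z (Suc k), l (Suc k), x k, z k)"

abbreviation \<Delta>x :: "nat \<Rightarrow> real^'n" where "\<Delta>x k \<equiv> x (Suc k) - x k"
abbreviation \<Delta>z :: "nat \<Rightarrow> real^'n" where "\<Delta>z k \<equiv> z (Suc k) - z k"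
abbreviation \<Delta>l :: "nat \<Rightarrow> real^'m" where "\<Delta>l k \<equiv> l (Suc k) - l k"

text \<open>Two consecutive steps are needed, since the change of the multiplier depends on both (\<open>dual_change_bound\<close>).\<close>

definition D :: "nat \<Rightarrow> real" where
  "D k = norm (\<Delta>x (Suc k)) + norm (\<Delta>z (Suc k)) + norm (\<Delta>x k) + norm (\<Delta>z k)"

lemma x_Suc_minimizes:
  "prox_aug_lagrangian (linearized h g (x k)) A b \<beta> \<gamma> (x (Suc k)) (z k) (l k)
     \<le> prox_aug_lagrangian (linearized h g (x k)) A b \<beta> \<gamma> u (z k) (l k)"
  using gen unfolding limeal_def is_arg_min_linorder by blast

lemma z_Suc: "z (Suc k) = z k - \<eta> *\<^sub>R (z k - x (Suc k))"
  and l_Suc: "l (Suc k) = l k + \<beta> *\<^sub>R (A *v x (Suc k) - b)"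
  using gen unfolding limeal_def by blast+

lemma \<gamma>_less: "\<gamma> < 1 / \<rho>" "\<rho> + Lh < 1 / \<gamma>"
proof -
  show "\<rho> + Lh < 1 / \<gamma>" using \<gamma> Lh(1) g_wc(1) by (simp add: field_simps)
  then have "\<rho> < 1 / \<gamma>" using Lh(1) by simp
  then show "\<gamma> < 1 / \<rho>" using \<gamma>(1) g_wc(1) by (simp add: field_simps)
qed

lemma Lg_pos: "Lg \<gamma> > 0"
  using g_ils \<gamma>(1) \<gamma>_less(1) unfolding implicit_lipschitz_subgradient_def by blast

text \<open>Minimality gives a quadratic minorant of \<open>g\<close> whose constant depends on \<open>A\<close>, \<open>\<beta>\<close> and \<open>\<gamma>\<close>, and weak convexity
  replaces this constant by \<open>\<rho> / 2\<close>.\<close>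

lemma g_sub_proximal: "proximal_subgradient (\<rho> / 2) g (x (Suc k)) (g_sub k)"
proof -
  obtain B where B: "B > 0" "\<And>u. norm (A *v u) \<le> norm u * B"
    using bounded_linear.pos_bounded[OF matrix_vector_mul_bounded_linear[of A]] by blast
  have "proximal_subgradient (\<beta> / 2 * B\<^sup>2 + 1 / (2 * \<gamma>)) g (x (Suc k)) (g_sub k)"
    unfolding proximal_subgradient_def
  proof
    fix u
    define d where "d = u - x (Suc k)"
    have "0 \<le> linearized h g (x k) u - linearized h g (x k) (x (Suc k))
        + (transpose A *v l (Suc k) + (1 / \<gamma>) *\<^sub>R (x (Suc k) - z k)) \<bullet> d
        + \<beta> / 2 * (norm (A *v d))\<^sup>2 + 1 / (2 * \<gamma>) * (norm d)\<^sup>2"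
      using x_Suc_minimizes[of k u]
        prox_aug_lagrangian_shift[OF l_Suc[of k], of "linearized h g (x k)" \<gamma> u "z k"]
      unfolding d_def by linarith
    moreover have "linearized h g (x k) u - linearized h g (x k) (x (Suc k))
        = g u - g (x (Suc k)) + gradient h (x k) \<bullet> d"
      by (simp add: linearized_def d_def inner_diff_right)
    moreover have "g_sub k \<bullet> d = - (gradient h (x k) \<bullet> d)
        - (transpose A *v l (Suc k) + (1 / \<gamma>) *\<^sub>R (x (Suc k) - z k)) \<bullet> d"
        unfolding g_sub_def inner_minus_left inner_add_left by simp
    moreover have "\<beta> / 2 * (norm (A *v d))\<^sup>2 \<le> \<beta> / 2 * (norm d * B)\<^sup>2"
      using B \<beta> by (intro mult_left_mono power_mono) auto
    moreover have "(\<beta> / 2 * B\<^sup>2 + 1 / (2 * \<gamma>)) * (norm d)\<^sup>2 = \<beta> / 2 * (norm d * B)\<^sup>2 + 1 / (2 * \<gamma>) * (norm d)\<^sup>2"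
      by (simp add: power_mult_distrib algebra_simps)
    ultimately show "g (x (Suc k)) + g_sub k \<bullet> (u - x (Suc k))
        - (\<beta> / 2 * B\<^sup>2 + 1 / (2 * \<gamma>)) * (norm (u - x (Suc k)))\<^sup>2 \<le> g u"
      unfolding d_def[symmetric] by linarith
  qed
  then show ?thesis by (rule proximal_subgradient_of_weakly_convex[OF g_wc(2)])
qed

lemma h_proximal: "proximal_subgradient (Lh / 2) h u (gradient h u)"
  unfolding proximal_subgradient_def
proof
  fix w show "h u + gradient h u \<bullet> (w - u) - Lh / 2 * (norm (w - u))\<^sup>2 \<le> h w"
    using abs_le_D2[OF lipschitz_gradient_quadratic_bound[OF h_diff Lh(2), of w u]] by linarith
qed

text \<open>The subproblem is strongly convex with modulus \<open>1 / \<gamma> - \<rho>\<close>, and linearizing \<open>h\<close> costs at most \<open>Lh / 2\<close> times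
  the squared step.\<close>

lemma descent_x_step:
  "P_aug (x (Suc k)) (z k) (l k) + (1 / \<gamma> - \<rho> - Lh) / 2 * (norm (\<Delta>x k))\<^sup>2 \<le> P_aug (x k) (z k) (l k)"
proof -
  define d where "d = x k - x (Suc k)"
  have "P_aug (x k) (z k) (l k) = P_aug (x (Suc k)) (z k) (l k)
      + (h (x k) + g (x k) - (h (x (Suc k)) + g (x (Suc k))))
      + (transpose A *v l (Suc k) + (1 / \<gamma>) *\<^sub>R (x (Suc k) - z k)) \<bullet> d
      + \<beta> / 2 * (norm (A *v d))\<^sup>2 + 1 / (2 * \<gamma>) * (norm d)\<^sup>2"
    unfolding d_def by (rule prox_aug_lagrangian_shift[OF l_Suc])
  moreover have "g (x (Suc k)) + g_sub k \<bullet> d - \<rho> / 2 * (norm d)\<^sup>2 \<le> g (x k)"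
    unfolding d_def by (rule proximal_subgradientD[OF g_sub_proximal])
  moreover have "h (x (Suc k)) + gradient h (x k) \<bullet> d - Lh / 2 * (norm d)\<^sup>2 \<le> h (x k)"
  proof -
    have "gradient h (x k) \<bullet> \<Delta>x k = - (gradient h (x k) \<bullet> d)" by (simp add: d_def inner_diff_right)
    moreover have "norm (\<Delta>x k) = norm d" by (simp add: d_def norm_minus_commute)
    ultimately show ?thesis
      using abs_le_D1[OF lipschitz_gradient_quadratic_bound[OF h_diff Lh(2), of "x (Suc k)" "x k"]]
      by simp
  qed
  moreover have "g_sub k \<bullet> d = - (gradient h (x k) \<bullet> d)
      - (transpose A *v l (Suc k) + (1 / \<gamma>) *\<^sub>R (x (Suc k) - z k)) \<bullet> d"
      unfolding g_sub_def inner_minus_left inner_add_left by simp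
  moreover have "0 \<le> \<beta> / 2 * (norm (A *v d))\<^sup>2" using \<beta> by simp
  moreover have "(1 / \<gamma> - \<rho> - Lh) / 2 * (norm d)\<^sup>2
      = 1 / (2 * \<gamma>) * (norm d)\<^sup>2 - \<rho> / 2 * (norm d)\<^sup>2 - Lh / 2 * (norm d)\<^sup>2"
    using \<gamma> by (simp add: field_simps)
  moreover have "norm (\<Delta>x k) = norm d" by (simp add: d_def norm_minus_commute)
  ultimately show ?thesis by (simp only:)
qed

lemma descent_z_step:
  "P_aug (x (Suc k)) (z (Suc k)) w + 1 / (2 * \<gamma>) * (2 / \<eta> - 1) * (norm (\<Delta>z k))\<^sup>2 = P_aug (x (Suc k)) (z k) w"
proof -
  define t where "t = x (Suc k) - z k"
  have "x (Suc k) - z (Suc k) = (1 - \<eta>) *\<^sub>R t" "\<Delta>z k = \<eta> *\<^sub>R t"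
    by (simp_all add: z_Suc t_def algebra_simps)
  then have n: "(norm (x (Suc k) - z (Suc k)))\<^sup>2 = (1 - \<eta>)\<^sup>2 * (norm t)\<^sup>2" "(norm (\<Delta>z k))\<^sup>2 = \<eta>\<^sup>2 * (norm t)\<^sup>2"
    by (simp_all add: power_mult_distrib)
  have factor: "E * (p * N) + E * q * (r * N) = E * N * (p + q * r)" for E p q r N :: real
    by (simp add: algebra_simps)
  have "1 / (2 * \<gamma>) * ((1 - \<eta>)\<^sup>2 * (norm t)\<^sup>2) + 1 / (2 * \<gamma>) * (2 / \<eta> - 1) * (\<eta>\<^sup>2 * (norm t)\<^sup>2)
      = 1 / (2 * \<gamma>) * (norm t)\<^sup>2 * ((1 - \<eta>)\<^sup>2 + (2 / \<eta> - 1) * \<eta>\<^sup>2)"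
    by (rule factor)
  also have "(1 - \<eta>)\<^sup>2 + (2 / \<eta> - 1) * \<eta>\<^sup>2 = 1"
    using \<eta> by (simp add: field_simps power2_eq_square)
  finally show ?thesis
    unfolding prox_aug_lagrangian_def n t_def[symmetric] by simp
qed

lemma dual_residual: "A *v x (Suc k) - b = (1 / \<beta>) *\<^sub>R \<Delta>l k"
  using \<beta> by (simp add: l_Suc)

lemma ascent_l_step:
  "P_aug (x (Suc k)) w (l (Suc k)) = P_aug (x (Suc k)) w (l k) + (norm (\<Delta>l k))\<^sup>2 / \<beta>"
proof -
  have "l (Suc k) \<bullet> (A *v x (Suc k) - b) = l k \<bullet> (A *v x (Suc k) - b) + \<Delta>l k \<bullet> (A *v x (Suc k) - b)"
    by (simp add: inner_diff_left)
  also have "\<Delta>l k \<bullet> (A *v x (Suc k) - b) = (norm (\<Delta>l k))\<^sup>2 / \<beta>"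
    unfolding dual_residual by (simp add: power2_norm_eq_inner)
  finally show ?thesis by (simp add: prox_aug_lagrangian_def aug_lagrangian_def)
qed

text \<open>By the optimality conditions at two consecutive iterates, \<open>\<gamma> A\<^sup>T\<close> applied to the change of the multiplier
  is a combination of increments of the subgradient of \<open>g\<close>, of \<open>\<nabla>h\<close>, of \<open>x\<close> and of \<open>z\<close>. The value of \<open>\<alpha>\<close> is
  chosen such that \<open>1 / (c_const \<gamma> A * \<beta>) \<le> \<alpha>\<close>.\<close>

lemma dual_change_bound:
  "(norm (\<Delta>l (Suc k)))\<^sup>2 / \<beta> \<le>
    3 * \<alpha> * ((1 + \<gamma> * Lg \<gamma>)\<^sup>2 * (norm (\<Delta>x (Suc k)))\<^sup>2 + \<gamma>\<^sup>2 * Lh\<^sup>2 * (norm (\<Delta>x k))\<^sup>2 + (norm (\<Delta>z k))\<^sup>2)"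
  (is "_ \<le> 3 * \<alpha> * ?S")
proof -
  define p where "p = \<gamma> * \<eta> * (1 - \<eta> / 2)"
  have p: "p > 0" using \<gamma> \<eta> by (simp add: p_def)
  define c where "c = c_const \<gamma> A"
  have \<alpha>c: "\<alpha> = (2 * \<beta> + p) / (2 * c * \<beta>\<^sup>2)" by (simp add: \<alpha>_eq p_def c_def)
  \<comment> \<open>the numerator of \<open>\<alpha>\<close> is positive, so \<open>\<alpha> > 0\<close> determines the sign of \<open>c\<close>\<close>
  have c: "c > 0"
    using \<alpha>(1) \<beta> p unfolding \<alpha>c by (simp add: zero_less_divide_iff zero_less_mult_iff not_less)
  have \<alpha>_ge: "1 / (c * \<beta>) \<le> \<alpha>"
    unfolding \<alpha>c using c \<beta> p by (simp add: field_simps power2_eq_square)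
  \<comment> \<open>by feasibility the multiplier moves within the range of \<open>A\<close>\<close>
  obtain u0 where u0: "b = A *v u0" using feasible by auto
  have "\<Delta>l (Suc k) = A *v (\<beta> *\<^sub>R (x (Suc (Suc k)) - u0))"
    by (simp add: l_Suc[of "Suc k"] u0 matrix_vector_mult_diff_distrib matrix_vector_mult_scaleR)
  then have "\<Delta>l (Suc k) \<in> range ((*v) A)" by blast
  then have eig: "min_pos_eigenvalue (transpose A ** A) * (norm (\<Delta>l (Suc k)))\<^sup>2 \<le> (norm (transpose A *v \<Delta>l (Suc k)))\<^sup>2"
    by (rule min_pos_eigenvalue_gram_bound)
  have "\<gamma> *\<^sub>R (transpose A *v \<Delta>l (Suc k)) =
      - (\<gamma> *\<^sub>R (g_sub (Suc k) - g_sub k) + \<Delta>x (Suc k)) - \<gamma> *\<^sub>R (gradient h (x (Suc k)) - gradient h (x k)) + \<Delta>z k"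
    using \<gamma> by (simp add: g_sub_def matrix_vector_mult_diff_distrib scaleR_diff_right scaleR_add_right
        del: transpose_matrix_vector)
  then have "norm (\<gamma> *\<^sub>R (transpose A *v \<Delta>l (Suc k))) \<le>
      norm (\<gamma> *\<^sub>R (g_sub (Suc k) - g_sub k) + \<Delta>x (Suc k)) + norm (\<gamma> *\<^sub>R (gradient h (x (Suc k)) - gradient h (x k))) + norm (\<Delta>z k)"
    by (metis norm_triangle_le norm_triangle_le_diff norm_minus_cancel order_refl add_mono)
  also have "norm (\<gamma> *\<^sub>R (g_sub (Suc k) - g_sub k) + \<Delta>x (Suc k)) \<le> (1 + \<gamma> * Lg \<gamma>) * norm (\<Delta>x (Suc k))"
  proof -
    have "norm (g_sub (Suc k) - g_sub k) \<le> Lg \<gamma> * norm (\<Delta>x (Suc k))"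
      by (rule implicit_lipschitz_subgradientD[OF g_ils \<gamma>(1) \<gamma>_less(1) g_wc(1) g_sub_proximal g_sub_proximal])
    then have "\<gamma> * norm (g_sub (Suc k) - g_sub k) \<le> \<gamma> * (Lg \<gamma> * norm (\<Delta>x (Suc k)))"
      using \<gamma> by (intro mult_left_mono) auto
    moreover have "norm (\<gamma> *\<^sub>R (g_sub (Suc k) - g_sub k)) = \<gamma> * norm (g_sub (Suc k) - g_sub k)"
      using \<gamma>(1) by simp
    moreover have "(1 + \<gamma> * Lg \<gamma>) * norm (\<Delta>x (Suc k)) = norm (\<Delta>x (Suc k)) + \<gamma> * (Lg \<gamma> * norm (\<Delta>x (Suc k)))"
      by (simp add: distrib_right)
    ultimately show ?thesis
      using norm_triangle_ineq[of "\<gamma> *\<^sub>R (g_sub (Suc k) - g_sub k)" "\<Delta>x (Suc k)"] by linarith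
  qed
  also have "norm (\<gamma> *\<^sub>R (gradient h (x (Suc k)) - gradient h (x k))) \<le> \<gamma> * Lh * norm (\<Delta>x k)"
    using lipschitz_onD[OF Lh(2), of "x (Suc k)" "x k"] \<gamma> by (simp add: dist_norm mult.assoc)
  finally have "(norm (\<gamma> *\<^sub>R (transpose A *v \<Delta>l (Suc k))))\<^sup>2 \<le>
      ((1 + \<gamma> * Lg \<gamma>) * norm (\<Delta>x (Suc k)) + \<gamma> * Lh * norm (\<Delta>x k) + norm (\<Delta>z k))\<^sup>2"
    by (intro power_mono) auto
  also have "\<dots> \<le> 3 * ?S"
    using sum3_sq_le[of "(1 + \<gamma> * Lg \<gamma>) * norm (\<Delta>x (Suc k))" "\<gamma> * Lh * norm (\<Delta>x k)" "norm (\<Delta>z k)"]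
    by (simp add: power_mult_distrib)
  finally have "\<gamma>\<^sup>2 * (norm (transpose A *v \<Delta>l (Suc k)))\<^sup>2 \<le> 3 * ?S" by (simp add: power_mult_distrib)
  moreover have "\<gamma>\<^sup>2 * (min_pos_eigenvalue (transpose A ** A) * (norm (\<Delta>l (Suc k)))\<^sup>2) \<le> \<gamma>\<^sup>2 * (norm (transpose A *v \<Delta>l (Suc k)))\<^sup>2"
    using eig by (rule mult_left_mono) simp
  ultimately have "c * (norm (\<Delta>l (Suc k)))\<^sup>2 \<le> 3 * ?S"
    unfolding c_def c_const_def by (simp only: mult.assoc)
  then have "(norm (\<Delta>l (Suc k)))\<^sup>2 / \<beta> \<le> 1 / (c * \<beta>) * (3 * ?S)"
    using c \<beta> by (simp add: field_simps)
  also have "\<dots> \<le> \<alpha> * (3 * ?S)" using \<alpha>_ge by (rule mult_right_mono) simp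
  finally show ?thesis by (simp only: mult_ac)
qed

lemma D_nonneg: "0 \<le> D k"
  by (simp add: D_def)

lemma norm_le_D:
  "norm (\<Delta>x (Suc k)) \<le> D k" "norm (\<Delta>z (Suc k)) \<le> D k" "norm (\<Delta>x k) \<le> D k" "norm (\<Delta>z k) \<le> D k"
  by (simp_all add: D_def)

lemma dual_change_le_D: "\<exists>K>0. \<forall>k. norm (\<Delta>l (Suc k)) \<le> K * D k"
proof -
  define M where "M = (1 + \<gamma> * Lg \<gamma>)\<^sup>2 + \<gamma>\<^sup>2 * Lh\<^sup>2 + 1"
  have M: "M > 0" by (simp add: M_def add_nonneg_pos)
  have K: "3 * \<alpha> * \<beta> * M > 0" using \<alpha>(1) \<beta> M by simp
  have "norm (\<Delta>l (Suc k)) \<le> sqrt (3 * \<alpha> * \<beta> * M) * D k" for k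
  proof (rule power2_le_imp_le)
    have "(1 + \<gamma> * Lg \<gamma>)\<^sup>2 * (norm (\<Delta>x (Suc k)))\<^sup>2 + \<gamma>\<^sup>2 * Lh\<^sup>2 * (norm (\<Delta>x k))\<^sup>2 + (norm (\<Delta>z k))\<^sup>2
        \<le> (1 + \<gamma> * Lg \<gamma>)\<^sup>2 * (D k)\<^sup>2 + \<gamma>\<^sup>2 * Lh\<^sup>2 * (D k)\<^sup>2 + (D k)\<^sup>2"
      by (intro add_mono mult_left_mono power_mono norm_le_D) auto
    also have "\<dots> = M * (D k)\<^sup>2" by (simp add: M_def distrib_right)
    finally have "(norm (\<Delta>l (Suc k)))\<^sup>2 / \<beta> \<le> 3 * \<alpha> * (M * (D k)\<^sup>2)"
      using dual_change_bound[of k] \<alpha>(1) by (meson mult_left_mono order_trans less_imp_le zero_less_mult_iff zero_less_numeral)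
    then have "(norm (\<Delta>l (Suc k)))\<^sup>2 \<le> 3 * \<alpha> * \<beta> * M * (D k)\<^sup>2"
      using \<beta> by (simp add: divide_le_eq mult_ac)
    also have "\<dots> = (sqrt (3 * \<alpha> * \<beta> * M) * D k)\<^sup>2"
      using K by (simp add: power_mult_distrib)
    finally show "(norm (\<Delta>l (Suc k)))\<^sup>2 \<le> (sqrt (3 * \<alpha> * \<beta> * M) * D k)\<^sup>2" .
    show "0 \<le> sqrt (3 * \<alpha> * \<beta> * M) * D k" using K D_nonneg by simp
  qed
  then show ?thesis using K by (intro exI[of _ "sqrt (3 * \<alpha> * \<beta> * M)"]) simp
qed

text \<open>The weight \<open>4 * \<alpha>\<close> in the Lyapunov function exceeds the \<open>3 * \<alpha>\<close> of \<open>dual_change_bound\<close>, so the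
  older step still contributes to the decrease. The upper bounds for \<open>\<alpha>\<close> make the coefficients \<open>m1\<close> and
  \<open>m2\<close> of the newer step positive.\<close>

lemma lyapunov_descent: "\<exists>c>0. \<forall>k. c * (D k)\<^sup>2 \<le> P_lya (Y k) - P_lya (Y (Suc k))"
proof -
  define a where "a = (1 / \<gamma> - \<rho> - Lh) / 2"
  define q where "q = 1 / (2 * \<gamma>) * (2 / \<eta> - 1)"
  define m1 where "m1 = a - 4 * \<alpha> * (\<gamma>\<^sup>2 * Lh\<^sup>2) - 3 * \<alpha> * (1 + \<gamma> * Lg \<gamma>)\<^sup>2"
  define m2 where "m2 = q - 4 * \<alpha>"
  define m3 where "m3 = \<alpha> * (\<gamma>\<^sup>2 * Lh\<^sup>2)"
  have "m1 > 0"
  proof -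
    have "1 + \<gamma> * Lg \<gamma> > 0" using \<gamma>(1) Lg_pos by (intro add_pos_pos) simp_all
    then have pos: "(1 + \<gamma> * Lg \<gamma>)\<^sup>2 > 0" by simp
    then have "(1 + \<gamma> * Lg \<gamma>)\<^sup>2 + \<gamma>\<^sup>2 * Lh\<^sup>2 > 0" by (simp add: add_pos_nonneg)
    then have "\<alpha> * (8 * \<gamma> * ((1 + \<gamma> * Lg \<gamma>)\<^sup>2 + \<gamma>\<^sup>2 * Lh\<^sup>2)) < 1 - \<gamma> * (\<rho> + Lh)"
      using \<alpha>(2) \<gamma>(1) by (simp add: pos_less_divide_eq)
    also have "\<dots> = 2 * \<gamma> * a" using \<gamma> by (simp add: a_def field_simps)
    finally have "(2 * \<gamma>) * (4 * \<alpha> * ((1 + \<gamma> * Lg \<gamma>)\<^sup>2 + \<gamma>\<^sup>2 * Lh\<^sup>2)) < (2 * \<gamma>) * a"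
      by (simp only: mult_ac)
    then have "4 * \<alpha> * ((1 + \<gamma> * Lg \<gamma>)\<^sup>2 + \<gamma>\<^sup>2 * Lh\<^sup>2) < a"
      using \<gamma>(1) by (simp only: mult_less_cancel_left_pos)
    moreover have "0 < \<alpha> * (1 + \<gamma> * Lg \<gamma>)\<^sup>2" using \<alpha>(1) pos by simp
    ultimately show ?thesis unfolding m1_def by (simp add: distrib_left)
  qed
  moreover have "m2 > 0"
  proof -
    have "\<alpha> < 1 / (8 * \<gamma>) * (2 / \<eta> - 1)" using \<alpha>(2) by simp
    also have "\<dots> = q / 4" by (simp add: q_def)
    finally show ?thesis by (simp add: m2_def)
  qed
  moreover have "m3 > 0" using \<alpha>(1) \<gamma>(1) Lh(1) by (simp add: m3_def)
  moreover define m where "m = min (min m1 m2) (min m3 \<alpha>)"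
  ultimately have m: "m > 0" "m \<le> m1" "m \<le> m2" "m \<le> m3" "m \<le> \<alpha>"
    using \<alpha>(1) by auto
  have "m / 4 * (D k)\<^sup>2 \<le> P_lya (Y k) - P_lya (Y (Suc k))" for k
  proof -
    define X1 Z1 X0 Z0 where "X1 = (norm (\<Delta>x (Suc k)))\<^sup>2" and "Z1 = (norm (\<Delta>z (Suc k)))\<^sup>2"
      and "X0 = (norm (\<Delta>x k))\<^sup>2" and "Z0 = (norm (\<Delta>z k))\<^sup>2"
    have sq: "X1 \<ge> 0" "Z1 \<ge> 0" "X0 \<ge> 0" "Z0 \<ge> 0" by (simp_all add: X1_def Z1_def X0_def Z0_def)
    have lya: "P_lya (Y j) = P_aug (x (Suc j)) (z (Suc j)) (l (Suc j))
        + 4 * \<alpha> * (norm (\<Delta>z j))\<^sup>2 + 4 * \<alpha> * (\<gamma>\<^sup>2 * Lh\<^sup>2) * (norm (\<Delta>x j))\<^sup>2" for j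
      by (simp add: P_limeal_def Y_def distrib_left)
    have "P_aug (x (Suc (Suc k))) (z (Suc (Suc k))) (l (Suc (Suc k)))
        \<le> P_aug (x (Suc k)) (z (Suc k)) (l (Suc k)) - a * X1 - q * Z1 + (norm (\<Delta>l (Suc k)))\<^sup>2 / \<beta>"
      using descent_x_step[of "Suc k"] descent_z_step[of "Suc k" "l (Suc k)"]
        ascent_l_step[of "Suc k" "z (Suc (Suc k))"]
      unfolding a_def q_def X1_def Z1_def by linarith
    moreover have "(norm (\<Delta>l (Suc k)))\<^sup>2 / \<beta> \<le> 3 * \<alpha> * (1 + \<gamma> * Lg \<gamma>)\<^sup>2 * X1 + 3 * \<alpha> * (\<gamma>\<^sup>2 * Lh\<^sup>2) * X0 + 3 * \<alpha> * Z0"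
      using dual_change_bound[of k] by (simp add: X1_def X0_def Z0_def distrib_left mult.assoc)
    moreover have "m1 * X1 = a * X1 - 4 * \<alpha> * (\<gamma>\<^sup>2 * Lh\<^sup>2) * X1 - 3 * \<alpha> * (1 + \<gamma> * Lg \<gamma>)\<^sup>2 * X1"
      "m2 * Z1 = q * Z1 - 4 * \<alpha> * Z1"
      "m3 * X0 = 4 * \<alpha> * (\<gamma>\<^sup>2 * Lh\<^sup>2) * X0 - 3 * \<alpha> * (\<gamma>\<^sup>2 * Lh\<^sup>2) * X0"
      by (simp_all only: m1_def m2_def m3_def left_diff_distrib)
    ultimately have "m1 * X1 + m2 * Z1 + m3 * X0 + \<alpha> * Z0 \<le> P_lya (Y k) - P_lya (Y (Suc k))"
      unfolding lya X1_def[symmetric] Z1_def[symmetric] X0_def[symmetric] Z0_def[symmetric] by linarith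
    moreover have "m * X1 + m * Z1 + m * X0 + m * Z0 \<le> m1 * X1 + m2 * Z1 + m3 * X0 + \<alpha> * Z0"
      using m sq by (intro add_mono mult_right_mono)
    moreover have "m / 4 * (D k)\<^sup>2 \<le> m / 4 * (4 * (X1 + Z1 + X0 + Z0))"
      using m sum4_sq_le unfolding D_def X1_def Z1_def X0_def Z0_def by (intro mult_left_mono) auto
    ultimately show ?thesis by (simp add: distrib_left)
  qed
  then show ?thesis using m(1) by (intro exI[of _ "m / 4"]) simp
qed

text \<open>At \<open>Y (k+1)\<close> the subgradient of \<open>g\<close> cancels all terms of the optimality condition. What remains are the
  errors of evaluating \<open>\<nabla>h\<close>, the multiplier and \<open>z\<close> one step earlier, and multiples of the last steps.\<close>

lemma relative_error: "\<exists>K>0. \<forall>k. \<exists>v \<in> limiting_subdiff P_lya (Y (Suc k)). norm v \<le> K * D k"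
proof -
  obtain K\<^sub>l where K\<^sub>l: "K\<^sub>l > 0" "\<And>k. norm (\<Delta>l (Suc k)) \<le> K\<^sub>l * D k" using dual_change_le_D by blast
  obtain B where B: "B > 0" "\<And>u. norm (transpose A *v u) \<le> norm u * B"
    using bounded_linear.pos_bounded[OF matrix_vector_mul_bounded_linear[of "transpose A"]] by blast
  define w where "w = 8 * \<alpha> * \<gamma>\<^sup>2 * Lh\<^sup>2"
  have w: "w \<ge> 0" using \<alpha>(1) by (simp add: w_def)
  define e where "e = (1 / \<gamma>) * (\<bar>1 - \<eta>\<bar> / \<eta>)"
  have e: "e \<ge> 0" using \<gamma>(1) \<eta> by (simp add: e_def)
  define K where "K = (Lh + K\<^sub>l * B + 1 / \<gamma> + w) + (e + 8 * \<alpha>) + K\<^sub>l / \<beta> + w + 8 * \<alpha>"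
  have K: "K > 0" unfolding K_def using Lh(1) K\<^sub>l(1) B(1) \<gamma>(1) w e \<alpha>(1) \<beta>
    by (intro add_pos_nonneg) (auto intro!: add_pos_nonneg)
  have "\<exists>v \<in> limiting_subdiff P_lya (Y (Suc k)). norm v \<le> K * D k" for k
  proof -
    let ?x = "x (Suc (Suc k))" and ?z = "z (Suc (Suc k))" and ?l = "l (Suc (Suc k))"
    define v1 where "v1 = gradient h ?x + g_sub (Suc k) + transpose A *v (?l + \<beta> *\<^sub>R (A *v ?x - b))
        + (1 / \<gamma>) *\<^sub>R (?x - ?z) + w *\<^sub>R (?x - x (Suc k))"
    define v2 where "v2 = (1 / \<gamma>) *\<^sub>R (?z - ?x) + (8 * \<alpha>) *\<^sub>R (?z - z (Suc k))"
    define v where "v = (v1, v2, A *v ?x - b, w *\<^sub>R (x (Suc k) - ?x), (8 * \<alpha>) *\<^sub>R (z (Suc k) - ?z))"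
    have "\<exists>C. proximal_subgradient C P_lya (Y (Suc k)) v"
      unfolding v_def v1_def v2_def w_def Y_def
      by (rule proximal_subgradient_P_limeal[OF g_sub_proximal h_proximal])
         (use \<beta> \<gamma>(1) \<alpha>(1) g_wc(1) Lh(1) in auto)
    then have "v \<in> limiting_subdiff P_lya (Y (Suc k))"
      using proximal_subgradient_imp_limiting by blast
    moreover have "norm v \<le> K * D k"
    proof -
      have res: "\<beta> *\<^sub>R (A *v ?x - b) = \<Delta>l (Suc k)" by (simp add: l_Suc[of "Suc k"])
      have v1: "v1 = (gradient h ?x - gradient h (x (Suc k))) + transpose A *v \<Delta>l (Suc k)
          - (1 / \<gamma>) *\<^sub>R \<Delta>z (Suc k) + w *\<^sub>R \<Delta>x (Suc k)"
        unfolding v1_def res matrix_vector_right_distrib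
        by (simp add: g_sub_def scaleR_diff_right del: transpose_matrix_vector)
      have "norm v1 \<le> norm (gradient h ?x - gradient h (x (Suc k))) + norm (transpose A *v \<Delta>l (Suc k))
          + norm ((1 / \<gamma>) *\<^sub>R \<Delta>z (Suc k)) + norm (w *\<^sub>R \<Delta>x (Suc k))"
        unfolding v1 by (intro norm_triangle_le norm_triangle_le_diff add_mono order_refl)
      also have "\<dots> \<le> Lh * D k + K\<^sub>l * D k * B + (1 / \<gamma>) * D k + w * D k"
      proof (intro add_mono)
        have "norm (gradient h ?x - gradient h (x (Suc k))) \<le> Lh * norm (\<Delta>x (Suc k))"
          using lipschitz_onD[OF Lh(2), of ?x "x (Suc k)"] by (simp add: dist_norm)
        also have "\<dots> \<le> Lh * D k" using Lh(1) by (intro mult_left_mono norm_le_D) simp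
        finally show "norm (gradient h ?x - gradient h (x (Suc k))) \<le> Lh * D k" .
        show "norm (transpose A *v \<Delta>l (Suc k)) \<le> K\<^sub>l * D k * B"
          using B(2)[of "\<Delta>l (Suc k)"] mult_right_mono[OF K\<^sub>l(2)[of k], of B] B(1) by linarith
        show "norm ((1 / \<gamma>) *\<^sub>R \<Delta>z (Suc k)) \<le> (1 / \<gamma>) * D k"
          unfolding norm_scaleR using \<gamma>(1) by (intro mult_mono norm_le_D) auto
        show "norm (w *\<^sub>R \<Delta>x (Suc k)) \<le> w * D k"
          unfolding norm_scaleR using w by (intro mult_mono norm_le_D) auto
      qed
      finally have n1: "norm v1 \<le> (Lh + K\<^sub>l * B + 1 / \<gamma> + w) * D k" by (simp add: algebra_simps)
      \<comment> \<open>the relaxed update makes the gap between \<open>x\<close> and \<open>z\<close> a multiple of the step of \<open>z\<close>\<close>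
      have "?z - ?x = ((\<eta> - 1) / \<eta>) *\<^sub>R \<Delta>z (Suc k)"
      proof -
        have "\<eta> *\<^sub>R (?z - ?x) = (\<eta> - 1) *\<^sub>R \<Delta>z (Suc k)"
          by (simp add: z_Suc[of "Suc k"] algebra_simps)
        then have "(1 / \<eta>) *\<^sub>R (\<eta> *\<^sub>R (?z - ?x)) = (1 / \<eta>) *\<^sub>R ((\<eta> - 1) *\<^sub>R \<Delta>z (Suc k))" by simp
        then show ?thesis using \<eta> by simp
      qed
      then have "norm ((1 / \<gamma>) *\<^sub>R (?z - ?x)) = e * norm (\<Delta>z (Suc k))"
        using \<gamma>(1) \<eta> by (simp add: e_def abs_minus_commute)
      then have "norm v2 \<le> e * norm (\<Delta>z (Suc k)) + (8 * \<alpha>) * norm (\<Delta>z (Suc k))"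
        unfolding v2_def using norm_triangle_ineq[of "(1 / \<gamma>) *\<^sub>R (?z - ?x)" "(8 * \<alpha>) *\<^sub>R \<Delta>z (Suc k)"] \<alpha>(1) by simp
      also have "\<dots> \<le> e * D k + (8 * \<alpha>) * D k"
        using e \<alpha>(1) by (intro add_mono mult_left_mono norm_le_D) auto
      finally have n2: "norm v2 \<le> (e + 8 * \<alpha>) * D k" by (simp add: algebra_simps)
      have n3: "norm (A *v ?x - b) \<le> (K\<^sub>l / \<beta>) * D k"
        unfolding dual_residual using K\<^sub>l(2)[of k] \<beta> by (simp add: divide_right_mono)
      have n4: "norm (w *\<^sub>R (x (Suc k) - ?x)) \<le> w * D k"
        unfolding norm_scaleR norm_minus_commute[of "x (Suc k)"] using w by (intro mult_mono norm_le_D) auto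
      have n5: "norm ((8 * \<alpha>) *\<^sub>R (z (Suc k) - ?z)) \<le> (8 * \<alpha>) * D k"
        unfolding norm_scaleR norm_minus_commute[of "z (Suc k)"] using \<alpha>(1) by (intro mult_mono norm_le_D) auto
      have "norm v \<le> (Lh + K\<^sub>l * B + 1 / \<gamma> + w) * D k + (e + 8 * \<alpha>) * D k + (K\<^sub>l / \<beta>) * D k + w * D k + (8 * \<alpha>) * D k"
        unfolding v_def by (rule order_trans[OF norm_quintuple_le]) (intro add_mono n1 n2 n3 n4 n5)
      also have "\<dots> = K * D k" by (simp add: K_def distrib_right)
      finally show ?thesis .
    qed
    ultimately show ?thesis by blast
  qed
  then show ?thesis using K by blast
qed

lemma Y_step: "\<exists>K>0. \<forall>k. dist (Y (Suc k)) (Y k) \<le> K * D k"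
proof -
  obtain K\<^sub>l where K\<^sub>l: "K\<^sub>l > 0" "\<And>k. norm (\<Delta>l (Suc k)) \<le> K\<^sub>l * D k" using dual_change_le_D by blast
  have "dist (Y (Suc k)) (Y k) \<le> (1 + K\<^sub>l) * D k" for k
  proof -
    have "dist (Y (Suc k)) (Y k) = norm (\<Delta>x (Suc k), \<Delta>z (Suc k), \<Delta>l (Suc k), \<Delta>x k, \<Delta>z k)"
      by (simp add: dist_norm Y_def)
    also have "\<dots> \<le> norm (\<Delta>x (Suc k)) + norm (\<Delta>z (Suc k)) + norm (\<Delta>l (Suc k)) + norm (\<Delta>x k) + norm (\<Delta>z k)"
      by (rule norm_quintuple_le)
    also have "\<dots> = D k + norm (\<Delta>l (Suc k))" by (simp add: D_def)
    also have "\<dots> \<le> (1 + K\<^sub>l) * D k" using K\<^sub>l(2)[of k] by (simp add: distrib_right)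
    finally show ?thesis .
  qed
  then show ?thesis using K\<^sub>l(1) by (intro exI[of _ "1 + K\<^sub>l"]) simp
qed

lemma continuous_P_lya: "continuous_on UNIV P_lya"
proof -
  have g: "continuous_on UNIV g" using g_wc(2) by (rule continuous_weakly_convex)
  have h: "continuous_on UNIV h"
    using h_diff by (simp add: continuous_on_eq_continuous_within differentiable_imp_continuous_within)
  have Amul: "continuous_on UNIV (\<lambda>u. A *v f u)" if "continuous_on UNIV f" for f :: "_ \<Rightarrow> real^'n"
    using that by (rule bounded_linear.continuous_on[OF matrix_vector_mul_bounded_linear])
  show ?thesis
    unfolding P_limeal_def prox_aug_lagrangian_def aug_lagrangian_def case_prod_beta
    by (intro continuous_intros Amul continuous_on_compose2[OF g] continuous_on_compose2[OF h]) auto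
qed

text \<open>\<open>P_lya\<close> is continuous because \<open>g\<close> is a finite convex function up to a quadratic. Hence it is bounded along the
  bounded sequence, where it decreases by \<open>lyapunov_descent\<close>.\<close>

lemma Lyapunov_converges: "\<exists>P. (\<lambda>k. P_lya (Y k)) \<longlonglongrightarrow> P \<and> (\<forall>k. P \<le> P_lya (Y k))"
proof -
  obtain c where c: "c > 0" "\<And>k. c * (D k)\<^sup>2 \<le> P_lya (Y k) - P_lya (Y (Suc k))" using lyapunov_descent by blast
  have dec: "decseq (\<lambda>k. P_lya (Y k))"
  proof (rule decseq_SucI)
    fix k
    have "0 \<le> c * (D k)\<^sup>2" using c(1) by simp
    then show "P_lya (Y (Suc k)) \<le> P_lya (Y k)" using c(2)[of k] by linarith
  qed
  have "bounded (range (\<lambda>k. P_lya (Y k)))"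
  proof -
    obtain R where R: "\<And>k. norm (x k, z k, l k) \<le> R" using bdd by (auto simp: bounded_iff)
    have n: "norm (x k) \<le> R" "norm (z k) \<le> R" "norm (l k) \<le> R" for k
      using R[of k] norm_fst_le[of "x k" "(z k, l k)"] norm_snd_le[of "(z k, l k)" "x k"]
        norm_fst_le[of "z k" "l k"] norm_snd_le[of "l k" "z k"] by linarith+
    have "norm (Y k) \<le> R + R + R + R + R" for k
      unfolding Y_def by (rule order_trans[OF norm_quintuple_le]) (intro add_mono n)
    then have "bounded (range Y)" by (auto simp: bounded_iff)
    then have "compact (closure (range Y))" by (simp add: compact_closure)
    then have "compact (P_lya ` closure (range Y))"
      by (rule compact_continuous_image[rotated]) (rule continuous_on_subset[OF continuous_P_lya], simp)
    then have "bounded (P_lya ` closure (range Y))" by (rule compact_imp_bounded)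
    then show ?thesis by (rule bounded_subset) (use closure_subset in blast)
  qed
  then obtain R where R: "\<And>k. \<bar>P_lya (Y k)\<bar> \<le> R" by (auto simp: bounded_iff)
  have "- R \<le> P_lya (Y k)" for k using R[of k] by linarith
  then obtain P where "(\<lambda>k. P_lya (Y k)) \<longlonglongrightarrow> P" "\<forall>k. P \<le> P_lya (Y k)"
    using decseq_convergent[OF dec] by blast
  then show ?thesis by blast
qed

lemma D_tendsto_0: "D \<longlonglongrightarrow> 0"
proof -
  obtain c where c: "c > 0" "\<And>k. c * (D k)\<^sup>2 \<le> P_lya (Y k) - P_lya (Y (Suc k))" using lyapunov_descent by blast
  obtain P where P: "(\<lambda>k. P_lya (Y k)) \<longlonglongrightarrow> P" using Lyapunov_converges by blast
  have "(\<lambda>k. (P_lya (Y k) - P_lya (Y (Suc k))) / c) \<longlonglongrightarrow> (P - P) / c"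
    using P LIMSEQ_Suc[OF P] c(1) by (intro tendsto_intros) auto
  then have lim: "(\<lambda>k. (P_lya (Y k) - P_lya (Y (Suc k))) / c) \<longlonglongrightarrow> 0" by simp
  have "(\<lambda>k. (D k)\<^sup>2) \<longlonglongrightarrow> 0"
  proof (rule real_tendsto_sandwich[OF _ _ tendsto_const lim])
    show "\<forall>\<^sub>F k in sequentially. (D k)\<^sup>2 \<le> (P_lya (Y k) - P_lya (Y (Suc k))) / c"
      using c by (simp add: pos_le_divide_eq mult.commute)
  qed auto
  then have "(\<lambda>k. sqrt ((D k)\<^sup>2)) \<longlonglongrightarrow> sqrt 0" by (rule tendsto_real_sqrt)
  then show ?thesis using D_nonneg by simp
qed

text \<open>The steps tend to \<open>0\<close>, and \<open>z k - x (k+1)\<close> is a multiple of a step, so along the subsequence the remaining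
  components of \<open>Y\<close> also tend to the limit of \<open>x\<close>. The subsequence is shifted by one because \<open>Y (k-1)\<close>
  contains \<open>x k\<close>.\<close>

lemma Y_cluster_point:
  assumes r: "strict_mono r" and lim: "((\<lambda>k. (x k, l k)) \<circ> r) \<longlonglongrightarrow> (x_lim, l_lim)"
  shows "\<exists>s. strict_mono s \<and> (Y \<circ> s) \<longlonglongrightarrow> (x_lim, x_lim, l_lim, x_lim, x_lim)"
proof -
  define s where "s j = r (Suc j) - 1" for j
  have Suc_s: "Suc (s j) = r (Suc j)" for j
    using seq_suble[OF r, of "Suc j"] by (simp add: s_def)
  have s: "strict_mono s"
  proof (rule strict_monoI_Suc)
    fix j
    have "r (Suc j) < r (Suc (Suc j))" using r by (simp add: strict_mono_Suc_iff)
    then show "s j < s (Suc j)" using Suc_s[of j] Suc_s[of "Suc j"] by linarith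
  qed
  have lim': "(\<lambda>j. (x (Suc (s j)), l (Suc (s j)))) \<longlonglongrightarrow> (x_lim, l_lim)"
    using LIMSEQ_Suc[OF lim] by (simp add: o_def Suc_s)
  have x1: "(\<lambda>j. x (Suc (s j))) \<longlonglongrightarrow> x_lim" and l1: "(\<lambda>j. l (Suc (s j))) \<longlonglongrightarrow> l_lim"
    using tendsto_fst[OF lim'] tendsto_snd[OF lim'] by simp_all
  have small: "(\<lambda>j. u (s j)) \<longlonglongrightarrow> 0" if "\<And>k. norm (u k) \<le> D k" for u :: "nat \<Rightarrow> real^'n"
  proof -
    have "u \<longlonglongrightarrow> 0" using that by (intro Lim_null_comparison[OF _ D_tendsto_0]) auto
    then show ?thesis by (rule filterlim_compose[OF _ filterlim_subseq[OF s]])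
  qed
  have dx: "(\<lambda>j. \<Delta>x (s j)) \<longlonglongrightarrow> 0" by (rule small) (rule norm_le_D)
  have dz: "(\<lambda>j. \<Delta>z (s j)) \<longlonglongrightarrow> 0" by (rule small) (rule norm_le_D)
  have "(\<lambda>j. x (Suc (s j)) - \<Delta>x (s j)) \<longlonglongrightarrow> x_lim - 0" by (intro tendsto_diff x1 dx)
  then have x0: "(\<lambda>j. x (s j)) \<longlonglongrightarrow> x_lim" by simp
  have "z k = x (Suc k) - (1 / \<eta>) *\<^sub>R \<Delta>z k" for k
    using \<eta> by (simp add: z_Suc)
  moreover have "(\<lambda>j. x (Suc (s j)) - (1 / \<eta>) *\<^sub>R \<Delta>z (s j)) \<longlonglongrightarrow> x_lim - (1 / \<eta>) *\<^sub>R 0"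
    by (intro tendsto_diff tendsto_scaleR tendsto_const x1 dz)
  ultimately have z0: "(\<lambda>j. z (s j)) \<longlonglongrightarrow> x_lim" by simp
  have "(\<lambda>j. z (s j) + \<Delta>z (s j)) \<longlonglongrightarrow> x_lim + 0" by (intro tendsto_add z0 dz)
  then have z1: "(\<lambda>j. z (Suc (s j))) \<longlonglongrightarrow> x_lim" by simp
  have "(Y \<circ> s) \<longlonglongrightarrow> (x_lim, x_lim, l_lim, x_lim, x_lim)"
    unfolding o_def Y_def by (intro tendsto_Pair x1 z1 l1 x0 z0)
  then show ?thesis using s by blast
qed

end

section \<open>Convergence and rates\<close>

text \<open>The desingularized inequality, solved for the energy and with the distance to the subdifferential
  replaced by the norm of any of its elements.\<close>

lemma KL_property_powr:
  assumes "KL_property q p \<theta>"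
  obtains r \<nu> C where "r > 0" "\<nu> > 0" "C > 0"
    and "\<And>y v. dist y p < r \<Longrightarrow> q p < q y \<Longrightarrow> q y < q p + \<nu> \<Longrightarrow> v \<in> limiting_subdiff q y \<Longrightarrow>
           (q y - q p) powr \<theta> \<le> C * norm v"
proof -
  from assms obtain U \<nu> c where U: "open U" "p \<in> U" and \<nu>: "\<nu> > 0" and c: "c > 0" and \<theta>: "\<theta> < 1"
    and ineq: "\<And>y. y \<in> U \<Longrightarrow> y \<in> dom_subdiff q \<Longrightarrow> q p < q y \<Longrightarrow> q y < q p + \<nu> \<Longrightarrow>
       deriv (\<lambda>s. c * s powr (1 - \<theta>)) (q y - q p) * infdist 0 (limiting_subdiff q y) \<ge> 1"
    unfolding KL_property_def by auto
  obtain r where r: "r > 0" "ball p r \<subseteq> U" using U by (meson open_contains_ball)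
  show thesis
  proof (rule that[of r \<nu> "c * (1 - \<theta>)"])
    fix y v assume y: "dist y p < r" "q p < q y" "q y < q p + \<nu>" and v: "v \<in> limiting_subdiff q y"
    define s where "s = q y - q p"
    have s: "s > 0" using y by (simp add: s_def)
    have "y \<in> U" using r y by (auto simp: dist_commute)
    moreover have "y \<in> dom_subdiff q" using v by (auto simp: dom_subdiff_def)
    ultimately have "1 \<le> deriv (\<lambda>s. c * s powr (1 - \<theta>)) s * infdist 0 (limiting_subdiff q y)"
      unfolding s_def using ineq y by blast
    also have "deriv (\<lambda>s. c * s powr (1 - \<theta>)) s = c * (1 - \<theta>) / s powr \<theta>"
    proof (rule DERIV_imp_deriv)
      have "((\<lambda>s. c * s powr (1 - \<theta>)) has_real_derivative c * ((1 - \<theta>) * s powr (1 - \<theta> - 1))) (at s)"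
        using s by (intro DERIV_cmult has_real_derivative_powr)
      then show "((\<lambda>s. c * s powr (1 - \<theta>)) has_real_derivative c * (1 - \<theta>) / s powr \<theta>) (at s)"
        by (simp add: powr_minus divide_inverse mult.assoc)
    qed
    also have "\<dots> * infdist 0 (limiting_subdiff q y) \<le> c * (1 - \<theta>) / s powr \<theta> * norm v"
    proof (intro mult_left_mono)
      show "infdist 0 (limiting_subdiff q y) \<le> norm v" using infdist_le[OF v, of 0] by simp
    qed (use c \<theta> in simp)
    finally show "(q y - q p) powr \<theta> \<le> c * (1 - \<theta>) * norm v"
      using s unfolding s_def[symmetric] by (simp add: field_simps)
  qed (use r \<nu> c \<theta> in auto)
qed

lemma norm_triple_le_quintuple: "norm (a, b, c) \<le> norm (a, b, c, d, e)"
proof (rule power2_le_imp_le)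
  show "(norm (a, b, c))\<^sup>2 \<le> (norm (a, b, c, d, e))\<^sup>2"
    by (simp add: norm_Pair)
qed simp

theorem proposition3:
  fixes A :: "real^'n^'m" and b :: "real^'m"
    and f h g :: "real^'n \<Rightarrow> real"
    and Lh \<rho>\<^sub>g \<beta> \<gamma> \<eta> \<alpha> \<theta> :: real
    and Lg :: "real \<Rightarrow> real"
    and x z :: "nat \<Rightarrow> real^'n" and l :: "nat \<Rightarrow> real^'m"
    and x_lim :: "real^'n" and l_lim :: "real^'m"
  assumes feasible: "{u. A *v u = b} \<noteq> {}"
    and f: "f = (\<lambda>u. h u + g u)"
    and h_diff: "\<And>u. h differentiable (at u)"
    and Lh: "Lh > 0" "Lh-lipschitz_on UNIV (gradient h)"
    and g_lsc: "lower_semicont g"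
    and g_wc: "\<rho>\<^sub>g > 0" "weakly_convex \<rho>\<^sub>g g"
    and g_ils: "implicit_lipschitz_subgradient \<rho>\<^sub>g g Lg"
    and \<beta>: "\<beta> > 0"
    and gen: "limeal h g A b \<beta> \<gamma> \<eta> x z l"
    and bdd: "bounded (range (\<lambda>k. (x k, z k, l k)))"
    and \<gamma>: "0 < \<gamma>" "\<gamma> < 1 / (\<rho>\<^sub>g + Lh)"
    and \<eta>: "0 < \<eta>" "\<eta> < 2"
    and \<alpha>_eq: "\<alpha> = (2 * \<beta> + \<gamma> * \<eta> * (1 - \<eta> / 2)) / (2 * c_const \<gamma> A * \<beta>\<^sup>2)"
    and \<alpha>: "0 < \<alpha>"
      "\<alpha> < min (1 / (8 * \<gamma>) * (2 / \<eta> - 1))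
               ((1 - \<gamma> * (\<rho>\<^sub>g + Lh)) / (8 * \<gamma> * ((1 + \<gamma> * Lg \<gamma>)\<^sup>2 + \<gamma>\<^sup>2 * Lh\<^sup>2)))"
    and limit_point: "\<exists>r. strict_mono r \<and> ((\<lambda>k. (x k, l k)) \<circ> r) \<longlonglongrightarrow> (x_lim, l_lim)"
    and \<theta>: "0 \<le> \<theta>" "\<theta> < 1"
    and KL: "KL_property (P_limeal f A b \<beta> \<gamma> \<alpha> Lh) (x_lim, x_lim, l_lim, x_lim, x_lim) \<theta>"
  shows "(\<lambda>k. (x k, z k, l k)) \<longlonglongrightarrow> (x_lim, x_lim, l_lim) \<and>
    (\<theta> = 0 \<longrightarrow> (\<exists>k0. \<forall>k\<ge>k0. (x k, z k, l k) = (x_lim, x_lim, l_lim))) \<and>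
    (0 < \<theta> \<and> \<theta> \<le> 1 / 2 \<longrightarrow>
       (\<exists>k0 c \<tau>. k0 > 0 \<and> c > 0 \<and> 0 < \<tau> \<and> \<tau> < 1 \<and>
          (\<forall>k\<ge>k0. norm ((x k, z k, l k) - (x_lim, x_lim, l_lim)) \<le> c * \<tau> ^ k))) \<and>
    (1 / 2 < \<theta> \<and> \<theta> < 1 \<longrightarrow>
       (\<exists>k0 c. k0 > 0 \<and> c > 0 \<and>
          (\<forall>k\<ge>k0. norm ((x k, z k, l k) - (x_lim, x_lim, l_lim))
                    \<le> c * real k powr (- ((1 - \<theta>) / (2 * \<theta> - 1))))))"
proof -
  interpret limeal_iteration A b h g Lh \<rho>\<^sub>g \<beta> \<gamma> \<eta> \<alpha> Lg x z l
    by unfold_locales fact+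
  define p where "p = (x_lim, x_lim, l_lim, x_lim, x_lim)"
  have KL_p: "KL_property P_lya p \<theta>" using KL unfolding f p_def .
  obtain c1 where c1: "c1 > 0" "\<And>k. c1 * (D k)\<^sup>2 \<le> P_lya (Y k) - P_lya (Y (Suc k))"
    using lyapunov_descent by blast
  obtain K1 where K1: "K1 > 0" "\<And>k. dist (Y (Suc k)) (Y k) \<le> K1 * D k"
    using Y_step by blast
  obtain K2 where K2: "K2 > 0" "\<And>k. \<exists>v \<in> limiting_subdiff P_lya (Y (Suc k)). norm v \<le> K2 * D k"
    using relative_error by blast
  obtain s where s: "strict_mono s" "(Y \<circ> s) \<longlonglongrightarrow> p"
    using limit_point Y_cluster_point unfolding p_def by blast
  obtain P where P: "(\<lambda>k. P_lya (Y k)) \<longlonglongrightarrow> P" "\<And>k. P \<le> P_lya (Y k)"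
    using Lyapunov_converges by blast
  have "(\<lambda>j. P_lya ((Y \<circ> s) j)) \<longlonglongrightarrow> P_lya p"
    using continuous_P_lya s(2) by (rule continuous_on_tendsto_compose) auto
  moreover have "(\<lambda>j. P_lya ((Y \<circ> s) j)) \<longlonglongrightarrow> P"
    using filterlim_compose[OF P(1) filterlim_subseq[OF s(1)]] by (simp add: o_def)
  ultimately have P_eq: "P = P_lya p" using LIMSEQ_unique by blast
  obtain r \<nu> C where C: "r > 0" "\<nu> > 0" "C > 0"
    and ineq: "\<And>y v. dist y p < r \<Longrightarrow> P_lya p < P_lya y \<Longrightarrow> P_lya y < P_lya p + \<nu> \<Longrightarrow>
           v \<in> limiting_subdiff P_lya y \<Longrightarrow> (P_lya y - P_lya p) powr \<theta> \<le> C * norm v"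
    using KL_property_powr[OF KL_p] by blast
  define E where "E k = P_lya (Y k) - P_lya p" for k
  have E_nonneg: "0 \<le> E k" for k using P(2)[of k] by (simp add: E_def P_eq)
  have E_lim: "E \<longlonglongrightarrow> 0"
    using tendsto_diff[OF P(1) tendsto_const[of "P_lya p"]] unfolding E_def P_eq by simp
  have descent: "c1 * (D k)\<^sup>2 \<le> E k - E (Suc k)" for k using c1(2)[of k] by (simp add: E_def)
  have CK: "C * K2 > 0" using C K2 by simp
  have KL_D: "E (Suc k) powr \<theta> \<le> C * K2 * D k"
    if "dist (Y (Suc k)) p < r" "0 < E (Suc k)" "E (Suc k) < \<nu>" for k
  proof -
    obtain v where v: "v \<in> limiting_subdiff P_lya (Y (Suc k))" "norm v \<le> K2 * D k" using K2(2) by blast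
    have "E (Suc k) powr \<theta> \<le> C * norm v"
      using ineq[OF that(1) _ _ v(1)] that(2,3) by (simp add: E_def)
    also have "\<dots> \<le> C * (K2 * D k)" using v(2) C by (intro mult_left_mono) auto
    finally show ?thesis by simp
  qed
  note rates = kl_descent_rates[OF D_nonneg E_nonneg E_lim c1(1) K1(1) CK C(1,2) \<theta> descent K1(2) s KL_D]
  \<comment> \<open>\<open>Y k\<close> starts with the iterate of index \<open>k + 1\<close>, so all rates are shifted by one below\<close>
  have proj: "norm ((x (Suc k), z (Suc k), l (Suc k)) - (x_lim, x_lim, l_lim)) \<le> dist (Y k) p" for k
    unfolding Y_def p_def dist_norm diff_Pair by (rule norm_triple_le_quintuple)
  have shift: "\<forall>k\<ge>Suc k0. Q k" if "\<And>k. k \<ge> k0 \<Longrightarrow> Q (Suc k)" for k0 Q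
  proof (intro allI impI)
    fix k assume "k \<ge> Suc k0"
    then show "Q k" using that[of "k - 1"] by (cases k) simp_all
  qed

  have "(\<lambda>k. dist (Y k) p) \<longlonglongrightarrow> 0" using rates(1) by (rule tendsto_dist_iff[THEN iffD1])
  then have "(\<lambda>k. (x (Suc k), z (Suc k), l (Suc k)) - (x_lim, x_lim, l_lim)) \<longlonglongrightarrow> 0"
    by (rule Lim_null_comparison[OF always_eventually[OF allI[OF proj]]])
  then have "(\<lambda>k. (x (Suc k), z (Suc k), l (Suc k))) \<longlonglongrightarrow> (x_lim, x_lim, l_lim)"
    by (rule LIM_zero_cancel)
  then have "(\<lambda>k. (x k, z k, l k)) \<longlonglongrightarrow> (x_lim, x_lim, l_lim)"
    by (rule LIMSEQ_imp_Suc)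
  moreover have "\<exists>k0. \<forall>k\<ge>k0. (x k, z k, l k) = (x_lim, x_lim, l_lim)" if "\<theta> = 0"
  proof -
    obtain k0 where k0: "\<And>k. k \<ge> k0 \<Longrightarrow> Y k = p" using rates(2) \<open>\<theta> = 0\<close> by blast
    have "\<forall>k\<ge>Suc k0. (x k, z k, l k) = (x_lim, x_lim, l_lim)"
      by (rule shift) (use k0 in \<open>auto simp: Y_def p_def\<close>)
    then show ?thesis ..
  qed
  moreover have "\<exists>k0 c \<tau>. k0 > 0 \<and> c > 0 \<and> 0 < \<tau> \<and> \<tau> < 1 \<and>
      (\<forall>k\<ge>k0. norm ((x k, z k, l k) - (x_lim, x_lim, l_lim)) \<le> c * \<tau> ^ k)" if th: "\<theta> \<le> 1 / 2"
  proof -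
    obtain k0 c \<tau> where c: "c > 0" "0 < \<tau>" "\<tau> < 1" "\<And>k. k \<ge> k0 \<Longrightarrow> dist (Y k) p \<le> c * \<tau> ^ k"
      using rates(3) th by blast
    have "\<forall>k\<ge>Suc k0. norm ((x k, z k, l k) - (x_lim, x_lim, l_lim)) \<le> c / \<tau> * \<tau> ^ k"
    proof (rule shift)
      fix k assume "k \<ge> k0"
      have "c * \<tau> ^ k = c / \<tau> * \<tau> ^ Suc k" using c by simp
      then show "norm ((x (Suc k), z (Suc k), l (Suc k)) - (x_lim, x_lim, l_lim)) \<le> c / \<tau> * \<tau> ^ Suc k"
        using proj[of k] c(4)[OF \<open>k \<ge> k0\<close>] by linarith
    qed
    moreover have "c / \<tau> > 0" using c by simp
    ultimately show ?thesis using c(2,3) zero_less_Suc by blast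
  qed
  moreover have "\<exists>k0 c. k0 > 0 \<and> c > 0 \<and>
      (\<forall>k\<ge>k0. norm ((x k, z k, l k) - (x_lim, x_lim, l_lim)) \<le> c * real k powr (- ((1 - \<theta>) / (2 * \<theta> - 1))))"
    if th: "1 / 2 < \<theta>"
  proof -
    define e where "e = (1 - \<theta>) / (2 * \<theta> - 1)"
    have e: "e \<ge> 0" using th \<theta> by (simp add: e_def)
    obtain k0 c where c: "c > 0" "\<And>k. k \<ge> k0 \<Longrightarrow> dist (Y k) p \<le> c * real k powr (- e)"
      using rates(4) th unfolding e_def by blast
    have "\<forall>k\<ge>Suc (Suc k0). norm ((x k, z k, l k) - (x_lim, x_lim, l_lim)) \<le> c * 2 powr e * real k powr (- e)"
    proof (rule shift)
      fix k assume k: "k \<ge> Suc k0"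
      have "real k powr (- e) \<le> (real (Suc k) / 2) powr (- e)"
        using k e by (intro powr_mono2') auto
      also have "\<dots> = 2 powr e * real (Suc k) powr (- e)" by (rule powr_minus_half) simp
      finally have "c * real k powr (- e) \<le> c * (2 powr e * real (Suc k) powr (- e))"
        using c(1) by (intro mult_left_mono) auto
      then show "norm ((x (Suc k), z (Suc k), l (Suc k)) - (x_lim, x_lim, l_lim))
          \<le> c * 2 powr e * real (Suc k) powr (- e)"
        using proj[of k] c(2)[of k] k by (simp only: mult.assoc) linarith
    qed
    moreover have "c * 2 powr e > 0" using c by simp
    ultimately show ?thesis unfolding e_def using zero_less_Suc by blast
  qed
  ultimately show ?thesis by blast
qed

end
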